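(* Fix $b>0$, $\sigma>0$, $p>0$ and $Z(0)\in[0,b]$. Let $v(\cdot,p)$ and $\gamma(p)$ be as in the context, and define the candidate policy $\theta(z,p)=\psi(v(z,p))$ for $z\in[0,b]$. Then $\theta(\cdot,p)$ is an admissible policy, and if $\xi^*$ is the cumulative cost process of the candidate policy and $\xi$ is the cumulative cost process of any admissible policy $\theta(\cdot)$ (each computed from a solution of the Skorohod problem associated with the respective policy), then $$\gamma(p)=\lim_{t\to\infty}\frac1t\mathbb{E}[\xi^*(t)]\le\liminf_{t\to\infty}\frac1t\mathbb{E}[\xi(t)].$$
   Context: $A\subseteq\mathbb{R}$ is closed with smallest element $\theta_*$; $c:A\to\mathbb{R}$ is nondecreasing, left-continuous, $c(\theta_* )=0$, $c(x)>0$ for $x>\theta_*$, and if $A$ is unbounded, $\inf\{c(x)/x:x\in A,x\ge y\}\uparrow\infty$ as $y\uparrow\infty$. $\phi(y)=\sup_{x\in A}\{yx-c(x)\}$ for $y\ge0$ (finite and attained), and $\psi(y)$ is the smallest maximizer in $A$. $\phi_*(p)=-\inf\{\phi(y):y\in[0,p]\}$; $\gamma(p)$ is the unique number in $(\phi_*(p),\infty)$ with $\tfrac12\sigma^2\int_0^p\frac{du}{\phi(u)+\gamma(p)}=b$; $G(v,p)=\tfrac12\sigma^2\int_0^v\frac{du}{\phi(u)+\gamma(p)}$ for $v\in[0,p]$; $v(\cdot,p):[0,b]\to[0,p]$ is the inverse of $G(\cdot,p)$. An admissible policy is a bounded measurable $\theta:[0,b]\to A$. A solution of the Skorohod problem associated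 with $\theta$ is a filtered probability space carrying a Brownian motion $X$ (drift $0$, variance $\sigma^2$, $X(0)=0$, martingale w.r.t. the filtration) and adapted processes $Z,L,U$ with $Z(t)=Z(0)+X(t)-\int_0^t\theta(Z(s))ds+L(t)-U(t)$, $Z(t)\in[0,b]$, $L,U$ nondecreasing continuous with $L(0)=U(0)=0$, and $\int_0^t1_{\{Z(s)>0\}}dL(s)=\int_0^t1_{\{Z(s)<b\}}dU(s)=0$ for all $t\ge0$. The cumulative cost process is $\xi(t)=\int_0^tc(\theta(Z(s)))ds+pU(t)$. *)

theory Defs
  imports "HOL-Probability.Probability"
begin

definition standing_assms :: "real set \<Rightarrow> (real \<Rightarrow> real) \<Rightarrow> bool" where
  "standing_assms A c \<longleftrightarrow>
     closed A \<and> A \<noteq> {} \<and> (\<exists>m\<in>A. \<forall>x\<in>A. m \<le> x) \<and>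
     mono_on A c \<and>
     (\<forall>x\<in>A. continuous (at x within (A \<inter> {..x})) c) \<and>
     c (Inf A) = 0 \<and>
     (\<forall>x\<in>A. x > Inf A \<longrightarrow> c x > 0) \<and>
     (\<not> bdd_above A \<longrightarrow>
        filterlim (\<lambda>y. Inf ((\<lambda>x. c x / x) ` {x\<in>A. y \<le> x})) at_top at_top)"

definition phi :: "real set \<Rightarrow> (real \<Rightarrow> real) \<Rightarrow> real \<Rightarrow> real" where
  "phi A c y = (SUP x\<in>A. y * x - c x)"

definition psi :: "real set \<Rightarrow> (real \<Rightarrow> real) \<Rightarrow> real \<Rightarrow> real" where
  "psi A c y = (LEAST x. x \<in> A \<and> y * x - c x = phi A c y)"

definition phi_star :: "real set \<Rightarrow> (real \<Rightarrow> real) \<Rightarrow> real \<Rightarrow> real" where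
  "phi_star A c p = - (INF y\<in>{0..p}. phi A c y)"

definition gamma :: "real set \<Rightarrow> (real \<Rightarrow> real) \<Rightarrow> real \<Rightarrow> real \<Rightarrow> real \<Rightarrow> real" where
  "gamma A c \<sigma> b p = (THE g. phi_star A c p < g \<and>
      (1/2) * \<sigma>\<^sup>2 * integral {0..p} (\<lambda>u. 1 / (phi A c u + g)) = b)"

definition Gfun :: "real set \<Rightarrow> (real \<Rightarrow> real) \<Rightarrow> real \<Rightarrow> real \<Rightarrow> real \<Rightarrow> real \<Rightarrow> real" where
  "Gfun A c \<sigma> b p v = (1/2) * \<sigma>\<^sup>2 * integral {0..v} (\<lambda>u. 1 / (phi A c u + gamma A c \<sigma> b p))"

definition vfun :: "real set \<Rightarrow> (real \<Rightarrow> real) \<Rightarrow> real \<Rightarrow> real \<Rightarrow> real \<Rightarrow> real \<Rightarrow> real" where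
  "vfun A c \<sigma> b p z = (THE v. v \<in> {0..p} \<and> Gfun A c \<sigma> b p v = z)"

definition cand_policy :: "real set \<Rightarrow> (real \<Rightarrow> real) \<Rightarrow> real \<Rightarrow> real \<Rightarrow> real \<Rightarrow> real \<Rightarrow> real" where
  "cand_policy A c \<sigma> b p z = psi A c (vfun A c \<sigma> b p z)"

definition admissible :: "real set \<Rightarrow> real \<Rightarrow> (real \<Rightarrow> real) \<Rightarrow> bool" where
  "admissible A b \<theta> \<longleftrightarrow>
     (\<forall>z\<in>{0..b}. \<theta> z \<in> A) \<and> bounded (\<theta> ` {0..b}) \<and>
     \<theta> \<in> borel_measurable (restrict_space borel {0..b})"

definition filtered_prob_space :: "'a measure \<Rightarrow> (real \<Rightarrow> 'a measure) \<Rightarrow> bool" where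
  "filtered_prob_space M F \<longleftrightarrow> prob_space M \<and>
     (\<forall>t\<ge>0. subalgebra M (F t)) \<and>
     (\<forall>s t. 0 \<le> s \<and> s \<le> t \<longrightarrow> sets (F s) \<subseteq> sets (F t))"

definition adapted :: "'a measure \<Rightarrow> (real \<Rightarrow> 'a measure) \<Rightarrow> (real \<Rightarrow> 'a \<Rightarrow> real) \<Rightarrow> bool" where
  "adapted M F Y \<longleftrightarrow> (\<forall>t\<ge>0. Y t \<in> borel_measurable (F t))"

definition brownian_motion :: "'a measure \<Rightarrow> real \<Rightarrow> (real \<Rightarrow> 'a \<Rightarrow> real) \<Rightarrow> bool" where
  "brownian_motion M \<sigma> X \<longleftrightarrow>
     (\<forall>t\<ge>0. X t \<in> borel_measurable M) \<and>
     (\<forall>\<omega>\<in>space M. X 0 \<omega> = 0) \<and>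
     (\<forall>\<omega>\<in>space M. continuous_on {0..} (\<lambda>t. X t \<omega>)) \<and>
     (\<forall>s t. 0 \<le> s \<and> s < t \<longrightarrow>
        distributed M lborel (\<lambda>\<omega>. X t \<omega> - X s \<omega>)
          (\<lambda>x. ennreal (normal_density 0 (\<sigma> * sqrt (t - s)) x))) \<and>
     (\<forall>(ts :: nat \<Rightarrow> real) n. 0 \<le> ts 0 \<and> strict_mono ts \<longrightarrow>
        prob_space.indep_vars M (\<lambda>_. borel) (\<lambda>i \<omega>. X (ts (Suc i)) \<omega> - X (ts i) \<omega>) {..<n})"

definition martingale :: "'a measure \<Rightarrow> (real \<Rightarrow> 'a measure) \<Rightarrow> (real \<Rightarrow> 'a \<Rightarrow> real) \<Rightarrow> bool" where
  "martingale M F X \<longleftrightarrow> adapted M F X \<and>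
     (\<forall>t\<ge>0. integrable M (X t)) \<and>
     (\<forall>s t A. 0 \<le> s \<and> s \<le> t \<and> A \<in> sets (F s) \<longrightarrow>
        set_lebesgue_integral M A (X t) = set_lebesgue_integral M A (X s))"

text \<open>Stieltjes measure of a nondecreasing continuous path L on [0,oo) (extended constantly to the left).\<close>
definition stieltjes :: "(real \<Rightarrow> real) \<Rightarrow> real measure" where
  "stieltjes L = interval_measure (\<lambda>s. L (max 0 s))"

definition skorohod_solution ::
  "'a measure \<Rightarrow> (real \<Rightarrow> 'a measure) \<Rightarrow> real \<Rightarrow> real \<Rightarrow> (real \<Rightarrow> real) \<Rightarrow> real \<Rightarrow>
   (real \<Rightarrow> 'a \<Rightarrow> real) \<Rightarrow> (real \<Rightarrow> 'a \<Rightarrow> real) \<Rightarrow> (real \<Rightarrow> 'a \<Rightarrow> real) \<Rightarrow> (real \<Rightarrow> 'a \<Rightarrow> real) \<Rightarrow> bool" where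
  "skorohod_solution M F \<sigma> b \<theta> z0 X Z L U \<longleftrightarrow>
     filtered_prob_space M F \<and>
     brownian_motion M \<sigma> X \<and> martingale M F X \<and>
     adapted M F Z \<and> adapted M F L \<and> adapted M F U \<and>
     (\<forall>\<omega>\<in>space M. \<forall>t\<ge>0.
        Z t \<omega> = z0 + X t \<omega> - integral {0..t} (\<lambda>s. \<theta> (Z s \<omega>)) + L t \<omega> - U t \<omega>) \<and>
     (\<forall>\<omega>\<in>space M. \<forall>t\<ge>0. Z t \<omega> \<in> {0..b}) \<and>
     (\<forall>\<omega>\<in>space M. mono_on {0..} (\<lambda>t. L t \<omega>) \<and> continuous_on {0..} (\<lambda>t. L t \<omega>) \<and> L 0 \<omega> = 0) \<and>
     (\<forall>\<omega>\<in>space M. mono_on {0..} (\<lambda>t. U t \<omega>) \<and> continuous_on {0..} (\<lambda>t. U t \<omega>) \<and> U 0 \<omega> = 0) \<and>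
     (\<forall>\<omega>\<in>space M. \<forall>t\<ge>0.
        (\<integral>\<^sup>+ s. indicator {s\<in>{0..t}. Z s \<omega> > 0} s \<partial>stieltjes (\<lambda>r. L r \<omega>)) = 0 \<and>
        (\<integral>\<^sup>+ s. indicator {s\<in>{0..t}. Z s \<omega> < b} s \<partial>stieltjes (\<lambda>r. U r \<omega>)) = 0)"

definition cost_process ::
  "(real \<Rightarrow> real) \<Rightarrow> real \<Rightarrow> (real \<Rightarrow> real) \<Rightarrow> (real \<Rightarrow> 'a \<Rightarrow> real) \<Rightarrow> (real \<Rightarrow> 'a \<Rightarrow> real) \<Rightarrow> real \<Rightarrow> 'a \<Rightarrow> real" where
  "cost_process c p \<theta> Z U t \<omega> = integral {0..t} (\<lambda>s. c (\<theta> (Z s \<omega>))) + p * U t \<omega>"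

text \<open>Expected cost E[xi(t)] (xi is nonnegative, so this is the nonnegative integral).\<close>
definition expected_cost ::
  "'a measure \<Rightarrow> (real \<Rightarrow> real) \<Rightarrow> real \<Rightarrow> (real \<Rightarrow> real) \<Rightarrow> (real \<Rightarrow> 'a \<Rightarrow> real) \<Rightarrow> (real \<Rightarrow> 'a \<Rightarrow> real) \<Rightarrow> real \<Rightarrow> ennreal" where
  "expected_cost M c p \<theta> Z U t = (\<integral>\<^sup>+ \<omega>. ennreal (cost_process c p \<theta> Z U t \<omega>) \<partial>M)"

end

theory Submission
  imports Defs
begin

text \<open>Write \<open>v\<close> for \<open>vfun\<close> and \<open>f z = \<integral>\<^sub>0\<^sup>z v\<close>. The definition of \<open>v\<close> as the inverse of \<open>Gfun\<close> says
  \<open>\<sigma>\<^sup>2/2 * v' = phi v + gamma\<close>, hence \<open>gamma \<le> \<sigma>\<^sup>2/2 * f'' z - x * f' z + c x\<close> for all \<open>x \<in> A\<close>, with equality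
  for \<open>x = psi (v z)\<close>, while \<open>f' 0 = 0\<close> and \<open>f' b = p\<close>. Applying the Ito formula to \<open>f (Z t)\<close> and taking
  expectations bounds \<open>E \<xi>(t) - gamma * t\<close> from below, and for the candidate policy also from
  above, by constants depending only on \<open>f\<close>.

  No stochastic integral is needed. Along dyadic partitions the sums of \<open>f' (Z s) * \<Delta>X\<close> converge
  pathwise almost surely, because the quadratic variation of \<open>X\<close> does (fourth moments of the
  increments and a summability argument). They are centered and bounded in \<open>L\<^sup>2\<close> by the martingale
  property, so their limit is centered too. Fatou's lemma gives its integrability, so no moment
  bound on the boundary processes \<open>L\<close> and \<open>U\<close> has to be established beforehand.\<close>

section \<open>The conjugate function, the constant gamma and the differential equation for v\<close>

text \<open>Left-continuity of \<open>c\<close> enters only as lower semicontinuity, which makes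
  maximizers exist. The conjugate \<open>phi\<close> is Lipschitz but may have kinks, for instance
  when \<open>A\<close> is finite, so \<open>f\<close> need not have a third derivative; Lipschitz
  continuity of f'' supplies the cubic Taylor remainder instead. The same Lipschitz bound makes the
  integral defining \<open>gamma\<close> blow up at \<open>phi_star\<close>, hence
  \<open>gamma\<close> exist. The limit of the sums is taken path by path because the remaining
  terms of the formula are awkward under an expectation: the path integrals are not given as
  measurable functions of \<omega>, and \<open>U T\<close> is not given as integrable. Both defects
  are repaired by reading these terms off from the limit. The second moments of the sums stay
  bounded since 0 \<le> f' \<le> p on [0,b]. Continuity has to be extracted from the equation itself
  before any partition sum can be controlled.\<close>

locale drift_control =
  fixes A :: "real set" and c :: "real \<Rightarrow> real" and b \<sigma> p :: real
  assumes std: "standing_assms A c" and b_pos: "b > 0" and sigma_pos: "\<sigma> > 0" and p_pos: "p > 0"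
begin

section \<open>Consequences of the standing assumptions\<close>

lemma A_closed: "closed A" and A_nonempty: "A \<noteq> {}" and c_mono: "mono_on A c"
  and c_Inf: "c (Inf A) = 0"
  and c_left_cont: "x \<in> A \<Longrightarrow> continuous (at x within (A \<inter> {..x})) c"
  using std unfolding standing_assms_def by auto

lemma A_bdd_below: "bdd_below A"
  using std unfolding standing_assms_def by auto

lemma Inf_in: "Inf A \<in> A"
  by (rule closed_contains_Inf[OF A_nonempty A_bdd_below A_closed])

lemma Inf_le: "x \<in> A \<Longrightarrow> Inf A \<le> x"
  by (rule cInf_lower[OF _ A_bdd_below])

lemma c_nonneg: "x \<in> A \<Longrightarrow> 0 \<le> c x"
  using mono_onD[OF c_mono Inf_in, of x] Inf_le c_Inf by auto

text \<open>To the left of \<open>x\<close> this is left-continuity; to the right monotonicity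
  already gives c u \<ge> c x.\<close>

lemma c_lower_semicontinuous:
  assumes "x \<in> A" "e > 0"
  shows "\<exists>d>0. \<forall>u\<in>A. \<bar>u - x\<bar> < d \<longrightarrow> c x - e < c u"
proof -
  obtain d where d: "d > 0" "\<And>u. u \<in> A \<inter> {..x} \<Longrightarrow> dist u x < d \<Longrightarrow> dist (c u) (c x) < e"
    using c_left_cont[OF assms(1)] assms(2) unfolding continuous_within_eps_delta by blast
  have "c x - e < c u" if u: "u \<in> A" "\<bar>u - x\<bar> < d" for u
  proof (cases "u \<le> x")
    case True
    then have "dist (c u) (c x) < e" using d(2)[of u] u by (auto simp: dist_real_def)
    then show ?thesis by (auto simp: dist_real_def)
  next
    case False
    then show ?thesis using mono_onD[OF c_mono assms(1) u(1)] assms(2) by auto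
  qed
  then show ?thesis using d(1) by blast
qed

text \<open>Superlinear growth of \<open>c\<close> makes every point beyond \<open>R\<close>
  strictly worse than \<open>Inf A\<close>, and one \<open>R\<close> serves all slopes in [0,p].
  This confines the maximization to a compact set and later bounds \<open>psi\<close>
  uniformly.\<close>

lemma exists_cutoff:
  "\<exists>R\<ge>Inf A. \<forall>x\<in>A. \<forall>y\<in>{0..p}. R < x \<longrightarrow> y * x - c x < y * Inf A"
proof (cases "bdd_above A")
  case True
  then obtain R where R: "\<And>x. x \<in> A \<Longrightarrow> x \<le> R" unfolding bdd_above_def by auto
  then show ?thesis using Inf_in by (intro exI[of _ R]) force
next
  case False
  then have "filterlim (\<lambda>y. Inf ((\<lambda>x. c x / x) ` {x\<in>A. y \<le> x})) at_top at_top"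
    using std unfolding standing_assms_def by auto
  then have "\<forall>\<^sub>F y in at_top. Inf ((\<lambda>x. c x / x) ` {x\<in>A. y \<le> x}) \<ge> p + 1"
    unfolding filterlim_at_top by blast
  then obtain N where N: "\<And>y. y \<ge> N \<Longrightarrow> Inf ((\<lambda>x. c x / x) ` {x\<in>A. y \<le> x}) \<ge> p + 1"
    unfolding eventually_at_top_linorder by blast
  \<comment> \<open>Beyond \<open>N\<close> the cost is at least (p + 1) x, and x > 1 is positive,
    so y x - c x \<le> -x. The entry \<open>p * \<bar>Inf A\<bar>\<close> puts this below y times
    \<open>Inf A\<close>.\<close>
  define R where "R = Max {N, 1, p * \<bar>Inf A\<bar>, Inf A}"
  have R: "N \<le> R" "1 \<le> R" "p * \<bar>Inf A\<bar> \<le> R" "Inf A \<le> R" by (auto simp: R_def)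
  have "y * x - c x < y * Inf A" if x: "x \<in> A" "R < x" and y: "0 \<le> y" "y \<le> p" for x y
  proof -
    have "bdd_below ((\<lambda>x. c x / x) ` {x\<in>A. R \<le> x})"
      using R c_nonneg by (intro bdd_belowI[of _ 0]) auto
    then have "Inf ((\<lambda>x. c x / x) ` {x\<in>A. R \<le> x}) \<le> c x / x"
      using x by (intro cInf_lower) auto
    then have "p + 1 \<le> c x / x" using N[OF R(1)] by simp
    then have "(p + 1) * x \<le> c x" using x R by (simp add: pos_le_divide_eq)
    moreover have "y * x \<le> p * x" using x R y by (intro mult_right_mono) auto
    moreover have "- (y * Inf A) \<le> p * \<bar>Inf A\<bar>"
    proof -
      have "- (y * Inf A) \<le> y * \<bar>Inf A\<bar>" using y mult_left_mono[of "- Inf A" "\<bar>Inf A\<bar>" y] by auto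
      also have "\<dots> \<le> p * \<bar>Inf A\<bar>" using y by (intro mult_right_mono) auto
      finally show ?thesis .
    qed
    moreover have "(p + 1) * x = p * x + x" by (simp add: algebra_simps)
    ultimately show ?thesis using x R by linarith
  qed
  then show ?thesis using R by auto
qed

section \<open>Existence of maximizers and the least maximizer\<close>

definition cutoff :: real where
  "cutoff = (SOME R. R \<ge> Inf A \<and> (\<forall>x\<in>A. \<forall>y\<in>{0..p}. R < x \<longrightarrow> y * x - c x < y * Inf A))"

lemma cutoff: "Inf A \<le> cutoff"
  "x \<in> A \<Longrightarrow> y \<in> {0..p} \<Longrightarrow> cutoff < x \<Longrightarrow> y * x - c x < y * Inf A"
  using someI_ex[OF exists_cutoff] unfolding cutoff_def[symmetric] by auto

text \<open>An upper semicontinuous function attains its maximum on a compact set: a maximizing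
  sequence in \<open>B\<close> has an accumulation point, and lower semicontinuity of
  \<open>c\<close> passes to the limit. Points above \<open>cutoff\<close> lose against
  \<open>Inf A\<close>.\<close>

lemma maximum_attained:
  assumes y: "y \<in> {0..p}"
  shows "\<exists>x\<in>A. \<forall>u\<in>A. y * u - c u \<le> y * x - c x"
proof -
  define B where "B = A \<inter> {Inf A..cutoff}"
  define h where "h u = y * u - c u" for u
  have B: "compact B" "Inf A \<in> B"
    using A_closed Inf_in cutoff(1) by (auto simp: B_def intro: closed_Int_compact)
  have bdd: "bdd_above (h ` B)"
  proof (rule bdd_aboveI)
    fix w assume "w \<in> h ` B"
    then obtain u where u: "u \<in> B" "w = y * u - c u" by (auto simp: h_def)
    then have "y * u \<le> y * cutoff" using y by (intro mult_left_mono) (auto simp: B_def)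
    then show "w \<le> y * cutoff" using u c_nonneg[of u] by (auto simp: B_def)
  qed
  define s where "s = Sup (h ` B)"
  have "\<exists>u\<in>B. s - 1 / real (Suc n) < h u" for n
    using less_cSupE[of "s - 1 / real (Suc n)" "h ` B"] B(2) unfolding s_def by force
  then obtain u where u: "\<And>n. u n \<in> B" "\<And>n. s - 1 / real (Suc n) < h (u n)" by metis
  obtain x r where x: "x \<in> B" "strict_mono r" "(u \<circ> r) \<longlonglongrightarrow> x"
    using B(1) u(1) unfolding compact_def by metis
  have xA: "x \<in> A" using x by (auto simp: B_def)
  have "s \<le> h x"
  proof (rule field_le_epsilon)
    fix e :: real assume e: "e > 0"
    obtain d where d: "d > 0" "\<And>w. w \<in> A \<Longrightarrow> \<bar>w - x\<bar> < d \<Longrightarrow> c x - e < c w"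
      using c_lower_semicontinuous[OF xA e] by blast
    have "\<forall>\<^sub>F n in sequentially. dist ((u \<circ> r) n) x < d"
      using x(3) d(1) by (rule tendstoD)
    then have ev: "\<forall>\<^sub>F n in sequentially. s - 1 / real (Suc (r n)) \<le> y * (u \<circ> r) n - c x + e"
    proof eventually_elim
      case (elim n)
      have "c x - e < c (u (r n))" using elim u(1) by (intro d(2)) (auto simp: B_def dist_real_def)
      then show ?case using u(2)[of "r n"] by (auto simp: h_def)
    qed
    have "(\<lambda>n. s - 1 / real (Suc (r n))) \<longlonglongrightarrow> s - 0"
      using LIMSEQ_subseq_LIMSEQ[OF LIMSEQ_inverse_real_of_nat x(2)]
      by (intro tendsto_diff tendsto_const) (simp add: o_def inverse_eq_divide)
    moreover have "(\<lambda>n. y * (u \<circ> r) n - c x + e) \<longlonglongrightarrow> y * x - c x + e"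
      by (intro tendsto_intros x(3))
    ultimately have "s - 0 \<le> y * x - c x + e"
      using ev by (intro tendsto_le[OF trivial_limit_sequentially]) auto
    then show "s \<le> h x + e" by (simp add: h_def)
  qed
  then have maxB: "h w \<le> h x" if "w \<in> B" for w
    using cSup_upper[OF imageI[OF that, of h] bdd] by (simp add: s_def)
  have "h w \<le> h x" if "w \<in> A" for w
  proof (cases "w \<le> cutoff")
    case True
    then show ?thesis using maxB Inf_le that by (auto simp: B_def)
  next
    case False
    then have "h w < y * Inf A" using cutoff(2)[OF that y] by (simp add: h_def)
    also have "\<dots> = h (Inf A)" using c_Inf by (simp add: h_def)
    also have "\<dots> \<le> h x" using maxB B(2) by simp
    finally show ?thesis by simp
  qed
  then show ?thesis using xA by (auto simp: h_def)
qed

lemma phi_ge: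
  assumes "y \<in> {0..p}" "x \<in> A" shows "y * x - c x \<le> phi A c y"
proof -
  obtain w where w: "w \<in> A" "\<And>u. u \<in> A \<Longrightarrow> y * u - c u \<le> y * w - c w"
    using maximum_attained[OF assms(1)] by blast
  have "bdd_above ((\<lambda>x. y * x - c x) ` A)" by (rule bdd_aboveI[of _ "y * w - c w"]) (use w in auto)
  then show ?thesis unfolding phi_def using assms(2) by (intro cSUP_upper)
qed

text \<open>\<open>LEAST\<close> over the reals is meaningful only if the set \<open>S\<close> of
  maximizers contains its infimum \<open>m\<close>. Maximizers just above \<open>m\<close> cost at
  least c m by monotonicity, so \<open>m\<close> is no worse than they are in the limit.\<close>

lemma psi_props:
  assumes y: "y \<in> {0..p}"
  shows psi_in: "psi A c y \<in> A" and phi_psi: "phi A c y = y * psi A c y - c (psi A c y)"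
proof -
  define S where "S = {x \<in> A. y * x - c x = phi A c y}"
  obtain w where w: "w \<in> A" "\<And>u. u \<in> A \<Longrightarrow> y * u - c u \<le> y * w - c w"
    using maximum_attained[OF assms(1)] by blast
  have "phi A c y \<le> y * w - c w" unfolding phi_def
    using A_nonempty w by (intro cSUP_least) auto
  then have "w \<in> S" using phi_ge[OF y w(1)] w(1) by (auto simp: S_def)
  then have S: "S \<noteq> {}" "S \<subseteq> A" "bdd_below S"
    using A_bdd_below by (auto simp: S_def intro: bdd_below_mono)
  define m where "m = Inf S"
  have m_le: "x \<in> S \<Longrightarrow> m \<le> x" for x unfolding m_def using S by (intro cInf_lower)
  have "m \<in> closure S" unfolding m_def using S by (intro closure_contains_Inf) auto
  then have mA: "m \<in> A" using closure_mono[OF S(2)] A_closed by auto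
  have "phi A c y \<le> y * m - c m"
  proof (rule field_le_epsilon)
    fix e :: real assume e: "e > 0"
    \<comment> \<open>Passing from \<open>x\<close> to \<open>m\<close> changes the linear term by
      at most y (x - m) \<le> e; the added 1 keeps the quotient defined at y = 0.\<close>
    obtain x where x: "x \<in> S" "x < m + e / (y + 1)"
      using cInf_lessD[of S "m + e / (y + 1)"] S e y unfolding m_def by (auto simp: divide_pos_pos)
    have "c m \<le> c x" using mono_onD[OF c_mono mA, of x] x S m_le by auto
    moreover have "y * (x - m) \<le> e"
    proof -
      have "y * (x - m) \<le> y * (e / (y + 1))" using x y by (intro mult_left_mono) auto
      also have "\<dots> \<le> e" using e y by (auto simp: field_simps)
      finally show ?thesis .
    qed
    moreover have "phi A c y = y * x - c x" using x by (auto simp: S_def)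
    ultimately show "phi A c y \<le> y * m - c m + e" by (simp add: algebra_simps)
  qed
  then have mS: "m \<in> S" using phi_ge[OF y mA] mA by (auto simp: S_def)
  have "psi A c y = m" unfolding psi_def
    using mS m_le by (intro Least_equality) (auto simp: S_def)
  then show "psi A c y \<in> A" "phi A c y = y * psi A c y - c (psi A c y)"
    using mS by (auto simp: S_def)
qed

lemma psi_ge: "y \<in> {0..p} \<Longrightarrow> Inf A \<le> psi A c y"
  using psi_in Inf_le by blast

lemma psi_le_cutoff:
  assumes y: "y \<in> {0..p}" shows "psi A c y \<le> cutoff"
proof (rule ccontr)
  assume "\<not> psi A c y \<le> cutoff"
  then have "phi A c y < y * Inf A"
    using cutoff(2)[OF psi_in[OF y] y] phi_psi[OF y] by simp
  moreover have "y * Inf A \<le> phi A c y" using phi_ge[OF y Inf_in] c_Inf by simp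
  ultimately show False by simp
qed

text \<open>Adding the two optimality inequalities cancels the costs and leaves (y' - y)(psi y' -
  psi y) \<ge> 0. Monotonicity is what makes the candidate policy Borel.\<close>

lemma psi_mono:
  assumes "y \<in> {0..p}" "y' \<in> {0..p}" "y \<le> y'"
  shows "psi A c y \<le> psi A c y'"
proof (cases "y = y'")
  case False
  let ?x = "psi A c y" and ?x' = "psi A c y'"
  have 1: "y * ?x' - c ?x' \<le> y * ?x - c ?x" "y' * ?x - c ?x \<le> y' * ?x' - c ?x'"
    using phi_ge[OF assms(1) psi_in[OF assms(2)]] phi_ge[OF assms(2) psi_in[OF assms(1)]]
      phi_psi assms by auto
  then have "0 \<le> (y' - y) * (?x' - ?x)" by (simp add: algebra_simps)
  then show ?thesis using False assms(3) by (simp add: zero_le_mult_iff)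
qed simp

section \<open>Lipschitz continuity and minimum of the conjugate function\<close>

definition lip :: real where "lip = \<bar>Inf A\<bar> + \<bar>cutoff\<bar> + 1"

lemma lip_pos: "lip > 0" by (simp add: lip_def add_nonneg_pos)

lemma psi_abs_le: "y \<in> {0..p} \<Longrightarrow> \<bar>psi A c y\<bar> \<le> lip"
  using psi_ge[of y] psi_le_cutoff[of y] unfolding lip_def by arith

text \<open>The maximizer psi y is a subgradient of \<open>phi\<close> at y, and all maximizers for
  slopes in [0,p] are bounded by \<open>lip\<close>.\<close>

lemma phi_lipschitz:
  assumes "y \<in> {0..p}" "y' \<in> {0..p}"
  shows "\<bar>phi A c y - phi A c y'\<bar> \<le> lip * \<bar>y - y'\<bar>"
proof -
  have *: "phi A c y - phi A c y' \<le> lip * \<bar>y - y'\<bar>" if "y \<in> {0..p}" "y' \<in> {0..p}" for y y'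
  proof -
    have "phi A c y - phi A c y' \<le> (y - y') * psi A c y"
      using phi_ge[OF that(2) psi_in[OF that(1)]] phi_psi[OF that(1)] by (simp add: algebra_simps)
    also have "\<dots> \<le> \<bar>y - y'\<bar> * \<bar>psi A c y\<bar>" by (metis abs_ge_self abs_mult)
    also have "\<dots> \<le> \<bar>y - y'\<bar> * lip" using psi_abs_le[OF that(1)] by (intro mult_left_mono) auto
    finally show ?thesis by (simp add: mult.commute)
  qed
  show ?thesis using *[OF assms] *[OF assms(2,1)] by (simp add: abs_le_iff abs_minus_commute)
qed

lemma phi_continuous: "continuous_on {0..p} (phi A c)"
proof (rule lipschitz_on_continuous_on[of lip])
  show "lip-lipschitz_on {0..p} (phi A c)"
    using lip_pos phi_lipschitz by (auto simp: lipschitz_on_def dist_real_def)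
qed

lemma phi_0: "phi A c 0 = 0"
proof -
  have 0: "0 \<in> {0..p}" using p_pos by auto
  have "phi A c 0 \<le> 0" using phi_psi[OF 0] c_nonneg[OF psi_in[OF 0]] by simp
  moreover have "0 \<le> phi A c 0" using phi_ge[OF 0 Inf_in] c_Inf by simp
  ultimately show ?thesis by simp
qed

lemma phi_star_attained: "\<exists>u\<in>{0..p}. phi A c u = - phi_star A c p \<and> (\<forall>y\<in>{0..p}. phi A c u \<le> phi A c y)"
proof -
  obtain u where u: "u \<in> {0..p}" "\<And>y. y \<in> {0..p} \<Longrightarrow> phi A c u \<le> phi A c y"
    using continuous_attains_inf[OF compact_Icc _ phi_continuous] p_pos by auto
  have "(INF y\<in>{0..p}. phi A c y) = phi A c u"
    by (rule cInf_eq_minimum) (use u in auto)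
  then show ?thesis using u by (auto simp: phi_star_def)
qed

lemma phi_ge_phi_star: "y \<in> {0..p} \<Longrightarrow> - phi_star A c p \<le> phi A c y"
  using phi_star_attained by auto

lemma phi_star_nonneg: "0 \<le> phi_star A c p"
  using phi_ge_phi_star[of 0] phi_0 p_pos by auto

section \<open>Existence and uniqueness of gamma\<close>

lemma inverse_phi_cont:
  "phi_star A c p < g \<Longrightarrow> continuous_on {0..p} (\<lambda>u. 1 / (phi A c u + g))"
  using phi_ge_phi_star by (intro continuous_intros phi_continuous) force

lemma inverse_phi_integrable:
  "phi_star A c p < g \<Longrightarrow> 0 \<le> v \<Longrightarrow> v \<le> w \<Longrightarrow> w \<le> p \<Longrightarrow> (\<lambda>u. 1 / (phi A c u + g)) integrable_on {v..w}"
  by (intro integrable_continuous_real continuous_on_subset[OF inverse_phi_cont]) auto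

lemma integral_inverse_phi_strict_antimono:
  assumes "phi_star A c p < g" "g < g'"
  shows "integral {0..p} (\<lambda>u. 1 / (phi A c u + g')) < integral {0..p} (\<lambda>u. 1 / (phi A c u + g))"
proof (rule integral_less_real)
  show "continuous_on {0..p} (\<lambda>u. 1 / (phi A c u + g'))" "continuous_on {0..p} (\<lambda>u. 1 / (phi A c u + g))"
    using assms by (auto intro!: inverse_phi_cont)
  show "{0<..<p} \<noteq> {}" using p_pos by simp
  fix u assume "u \<in> {0<..<p}"
  then show "1 / (phi A c u + g') < 1 / (phi A c u + g)"
    using phi_ge_phi_star[of u] assms by (intro divide_strict_left_mono mult_pos_pos) auto
qed

text \<open>Near a minimizer \<open>u\<close> of \<open>phi\<close>, the Lipschitz bound makes the integrand at least
  \<open>1 / (lip * \<bar>x - u\<bar> + e)\<close> with \<open>e = g - phi_star\<close>, so the integral diverges logarithmically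
  as \<open>e \<rightarrow> 0\<close>.\<close>
lemma integral_inverse_phi_unbounded:
  "\<exists>g>phi_star A c p. B \<le> integral {0..p} (\<lambda>u. 1 / (phi A c u + g))"
proof -
  obtain u where u: "u \<in> {0..p}" "phi A c u = - phi_star A c p" using phi_star_attained by blast
  define K where "K = lip"
  \<comment> \<open>Wherever the minimizer \<open>u\<close> lies in [0,p], there is room of length
    p/2 on at least one side of it; the two cases below integrate over that side.\<close>
  define q where "q = p / 2"
  have K: "K > 0" using lip_pos by (simp add: K_def)
  have q: "q > 0" using p_pos by (simp add: q_def)
  \<comment> \<open>Solves (ln (K q) - ln e) / K = B.\<close>
  define e where "e = K * q * exp (- (K * B))"
  have e: "e > 0" using K q by (simp add: e_def)
  define g where "g = phi_star A c p + e"
  have g: "g > phi_star A c p" using e by (simp add: g_def)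
  have lnB: "B \<le> (ln (K * q + e) - ln e) / K"
  proof -
    have "ln e = ln (K * q) - K * B" using K q by (simp add: e_def ln_mult)
    moreover have "ln (K * q) \<le> ln (K * q + e)" using K q e by (simp add: add_pos_pos)
    ultimately show ?thesis using K by (simp add: pos_le_divide_eq mult.commute)
  qed
  have bound: "1 / (K * \<bar>x - u\<bar> + e) \<le> 1 / (phi A c x + g)" if "x \<in> {0..p}" for x
    using phi_lipschitz[OF that u(1)] u(2) phi_ge_phi_star[OF that] e
    by (intro divide_left_mono mult_pos_pos) (auto simp: K_def g_def)
  have pos: "0 \<le> 1 / (phi A c x + g)" if "x \<in> {0..p}" for x
    using phi_ge_phi_star[OF that] g by auto
  have via: "B \<le> integral {0..p} (\<lambda>u. 1 / (phi A c u + g))"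
    if s: "0 \<le> s" "s + q \<le> p" and i: "((\<lambda>x. 1 / (K * \<bar>x - u\<bar> + e)) has_integral (ln (K * q + e) - ln e) / K) {s..s+q}" for s
  proof -
    have int: "(\<lambda>u. 1 / (phi A c u + g)) integrable_on {s..s+q}"
      using s q g by (intro inverse_phi_integrable) auto
    have "B \<le> (ln (K * q + e) - ln e) / K" by (rule lnB)
    also have "\<dots> \<le> integral {s..s+q} (\<lambda>u. 1 / (phi A c u + g))"
      by (rule has_integral_le[OF i integrable_integral[OF int]]) (use s bound in auto)
    also have "\<dots> \<le> integral {0..p} (\<lambda>u. 1 / (phi A c u + g))"
      using s q g p_pos int pos by (intro integral_subset_le inverse_phi_integrable) auto
    finally show ?thesis .
  qed
  have "B \<le> integral {0..p} (\<lambda>u. 1 / (phi A c u + g))"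
  proof (cases "u \<le> q")
    case True
    have "((\<lambda>x. 1 / (K * \<bar>x - u\<bar> + e)) has_integral
        (ln (K * ((u + q) - u) + e) / K - ln (K * (u - u) + e) / K)) {u..u+q}"
    proof (rule fundamental_theorem_of_calculus)
      fix x assume x: "x \<in> {u..u+q}"
      have "K * (x - u) \<ge> 0" using x K by simp
      then have *: "K * (x - u) + e > 0" using e by linarith
      show "((\<lambda>x. ln (K * (x - u) + e) / K) has_vector_derivative 1 / (K * \<bar>x - u\<bar> + e)) (at x within {u..u+q})"
        unfolding has_real_derivative_iff_has_vector_derivative[symmetric]
        using * x K by (auto intro!: derivative_eq_intros simp: divide_simps)
    qed (use q in auto)
    then show ?thesis using True u q by (intro via[of u]) (auto simp: q_def diff_divide_distrib)
  next
    case False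
    have "((\<lambda>x. 1 / (K * \<bar>x - u\<bar> + e)) has_integral
        (- ln (K * (u - u) + e) / K - - ln (K * (u - (u - q)) + e) / K)) {u-q..u}"
    proof (rule fundamental_theorem_of_calculus)
      fix x assume x: "x \<in> {u-q..u}"
      have "K * (u - x) \<ge> 0" using x K by simp
      then have *: "K * (u - x) + e > 0" using e by linarith
      show "((\<lambda>x. - ln (K * (u - x) + e) / K) has_vector_derivative 1 / (K * \<bar>x - u\<bar> + e)) (at x within {u-q..u})"
        unfolding has_real_derivative_iff_has_vector_derivative[symmetric]
        using * x K by (auto intro!: derivative_eq_intros simp: divide_simps)
    qed (use q in auto)
    then show ?thesis using False u q by (intro via[of "u - q"]) (auto simp: q_def diff_divide_distrib)
  qed
  then show ?thesis using g by blast
qed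

text \<open>The integral is continuous and strictly decreasing in \<open>g\<close>, arbitrarily
  large near \<open>phi_star\<close> and small for large \<open>g\<close>. The intermediate value
  theorem and strictness give a unique solution, so the \<open>THE\<close> in \<open>gamma\<close>
  denotes it.\<close>

lemma gamma_props:
  shows gamma_gt: "phi_star A c p < gamma A c \<sigma> b p"
    and gamma_eq: "(1/2) * \<sigma>\<^sup>2 * integral {0..p} (\<lambda>u. 1 / (phi A c u + gamma A c \<sigma> b p)) = b"
proof -
  let ?I = "\<lambda>g. integral {0..p} (\<lambda>u. 1 / (phi A c u + g))"
  define B where "B = 2 * b / \<sigma>\<^sup>2"
  have B: "B > 0" using b_pos sigma_pos by (simp add: B_def)
  obtain g1 where g1: "g1 > phi_star A c p" "B \<le> ?I g1" using integral_inverse_phi_unbounded by blast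
  \<comment> \<open>From phi_star + p/B on, the integrand is at most B/p on an interval of length p,
    so the integral is at most B.\<close>
  define g2 where "g2 = max g1 (phi_star A c p + p / B)"
  have g2: "g1 \<le> g2" "phi_star A c p + p / B \<le> g2" by (auto simp: g2_def)
  have "?I g2 \<le> integral {0..p} (\<lambda>_. B / p)"
  proof (rule integral_le)
    fix u assume u: "u \<in> {0..p}"
    have "p / B > 0" using p_pos B by simp
    then have "1 / (phi A c u + g2) \<le> 1 / (p / B)"
      using phi_ge_phi_star[OF u] g2 p_pos B by (intro divide_left_mono mult_pos_pos) linarith+
    then show "1 / (phi A c u + g2) \<le> B / p" by simp
  qed (use g1 g2 p_pos in \<open>auto intro!: inverse_phi_integrable\<close>)
  then have I2: "?I g2 \<le> B" using p_pos by simp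
  have "continuous_on ({g1..g2} \<times> {0..p}) (\<lambda>(g, u). 1 / (phi A c u + g))"
  proof -
    have "continuous_on ({g1..g2} \<times> {0..p}) (\<lambda>x. phi A c (snd x))"
      by (rule continuous_on_compose2[OF phi_continuous continuous_on_snd[OF continuous_on_id]]) auto
    then have "continuous_on ({g1..g2} \<times> {0..p}) (\<lambda>x. 1 / (phi A c (snd x) + fst x))"
      using phi_ge_phi_star g1 by (intro continuous_intros) force+
    then show ?thesis by (simp add: case_prod_unfold)
  qed
  then have "continuous_on {g1..g2} ?I"
    using integral_continuous_on_param[of "{g1..g2}" 0 p "\<lambda>g u. 1 / (phi A c u + g)"] by simp
  then obtain g where g: "g1 \<le> g" "g \<le> g2" "?I g = B"
    using IVT2'[of ?I g2 B g1] I2 g1 g2 by auto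
  have "\<exists>!g. phi_star A c p < g \<and> (1/2) * \<sigma>\<^sup>2 * ?I g = b"
  proof (rule ex1I[of _ g])
    show "phi_star A c p < g \<and> (1/2) * \<sigma>\<^sup>2 * ?I g = b" using g g1 sigma_pos by (auto simp: B_def)
    fix g' assume g': "phi_star A c p < g' \<and> (1/2) * \<sigma>\<^sup>2 * ?I g' = b"
    then have "\<sigma>\<^sup>2 * ?I g' = \<sigma>\<^sup>2 * ?I g" using g sigma_pos by (simp add: B_def)
    then have "?I g' = ?I g" using sigma_pos by simp
    then show "g' = g"
      using integral_inverse_phi_strict_antimono[of g g'] integral_inverse_phi_strict_antimono[of g' g] g g1 g'
      by (cases g g' rule: linorder_cases) auto
  qed
  from theI'[OF this] show "phi_star A c p < gamma A c \<sigma> b p"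
    "(1/2) * \<sigma>\<^sup>2 * ?I (gamma A c \<sigma> b p) = b"
    unfolding gamma_def by auto
qed

definition gam :: real where "gam = gamma A c \<sigma> b p"

lemma gam_pos: "gam > 0"
  using gamma_gt phi_star_nonneg by (simp add: gam_def)

section \<open>The inverse pair G and v\<close>

definition slope :: "real \<Rightarrow> real" where "slope y = 2 / \<sigma>\<^sup>2 * (phi A c y + gam)"

lemma slope_pos: "y \<in> {0..p} \<Longrightarrow> slope y > 0"
  using phi_ge_phi_star[of y] gamma_gt sigma_pos by (auto simp: slope_def gam_def)

abbreviation "G \<equiv> Gfun A c \<sigma> b p"
abbreviation "v \<equiv> vfun A c \<sigma> b p"

lemma G_0: "G 0 = 0" and G_p: "G p = b"
  using gamma_eq by (auto simp: Gfun_def)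

lemma G_deriv:
  assumes "y \<in> {0..p}" shows "(G has_real_derivative 1 / slope y) (at y within {0..p})"
proof -
  have "((\<lambda>x. integral {0..x} (\<lambda>u. 1 / (phi A c u + gam))) has_real_derivative 1 / (phi A c y + gam)) (at y within {0..p})"
    using inverse_phi_cont[OF gamma_gt] assms unfolding gam_def by (rule integral_has_real_derivative)
  from DERIV_cmult[OF this, of "(1/2) * \<sigma>\<^sup>2"]
  show ?thesis unfolding Gfun_def gam_def[symmetric] by (simp add: slope_def)
qed

lemma G_continuous: "continuous_on {0..p} G"
  by (rule DERIV_continuous_on[OF G_deriv])

lemma G_strict_mono:
  assumes "x \<in> {0..p}" "y \<in> {0..p}" "x < y" shows "G x < G y"
proof (rule DERIV_pos_imp_increasing_open[OF assms(3)])
  fix w assume w: "x < w" "w < y"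
  then have "w \<in> interior {0..p}" using assms by auto
  moreover have "w \<in> {0..p}" using assms w by auto
  ultimately have "(G has_real_derivative 1 / slope w) (at w)"
    using G_deriv[of w] at_within_interior[of w "{0..p}"] by simp
  moreover have "1 / slope w > 0" using slope_pos[of w] assms w by auto
  ultimately show "\<exists>z. (G has_real_derivative z) (at w) \<and> 0 < z" by blast
next
  show "continuous_on {x..y} G" by (rule continuous_on_subset[OF G_continuous]) (use assms in auto)
qed

lemma G_image: "G ` {0..p} = {0..b}"
proof
  have mono: "G x \<le> G y" if "x \<in> {0..p}" "y \<in> {0..p}" "x \<le> y" for x y
    using G_strict_mono[OF that(1,2)] that by (cases "x = y") auto
  show "G ` {0..p} \<subseteq> {0..b}" using mono[of 0] mono[of _ p] G_0 G_p p_pos by auto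
  show "{0..b} \<subseteq> G ` {0..p}"
    using IVT'[of G 0 _ p] G_continuous G_0 G_p p_pos by fastforce
qed

lemma G_inj: "inj_on G {0..p}"
  by (rule linorder_inj_onI) (use G_strict_mono in fastforce)+

lemma v_G: "y \<in> {0..p} \<Longrightarrow> v (G y) = y"
  unfolding vfun_def using G_inj by (intro the_equality) (auto dest: inj_onD)

lemma v_range: "z \<in> {0..b} \<Longrightarrow> v z \<in> {0..p}" and G_v: "z \<in> {0..b} \<Longrightarrow> G (v z) = z"
proof -
  assume "z \<in> {0..b}"
  then obtain y where "y \<in> {0..p}" "z = G y" using G_image by blast
  then show "v z \<in> {0..p}" "G (v z) = z" using v_G by simp_all
qed

lemma v_0: "v 0 = 0" and v_b: "v b = p"
  using v_G[of 0] v_G[of p] G_0 G_p p_pos by auto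

lemma v_mono: "z \<in> {0..b} \<Longrightarrow> z' \<in> {0..b} \<Longrightarrow> z \<le> z' \<Longrightarrow> v z \<le> v z'"
  using G_strict_mono[of "v z'" "v z"] v_range[of z] v_range[of z'] G_v[of z] G_v[of z']
  by (cases "v z \<le> v z'") auto

text \<open>Inverse function rule for \<open>G\<close>, whose derivative is 1/slope. The derivative
  is taken within [0,b], hence one-sided at the two barriers.\<close>

lemma v_deriv:
  assumes "z \<in> {0..b}" shows "(v has_real_derivative slope (v z)) (at z within {0..b})"
proof -
  let ?y = "v z"
  have y: "?y \<in> {0..p}" "G ?y = z" using v_range G_v assms by auto
  have "continuous_on (G ` {0..p}) v"
    using G_continuous v_G by (intro continuous_on_inv) auto
  then have cont: "continuous (at (G ?y) within G ` {0..p}) v"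
    using y(1) by (auto simp: continuous_on_eq_continuous_within)
  have "(v has_derivative (\<lambda>h. slope ?y * h)) (at (G ?y) within G ` {0..p})"
  proof (rule has_derivative_inverse_within)
    show "(G has_derivative (\<lambda>h. 1 / slope ?y * h)) (at ?y within {0..p})"
      using G_deriv[OF y(1)] unfolding has_field_derivative_def .
    show "(\<lambda>h. slope ?y * h) \<circ> (\<lambda>h. 1 / slope ?y * h) = id"
      using slope_pos[OF y(1)] by (auto simp: fun_eq_iff)
    show "linear (\<lambda>h. slope ?y * h)"
      by (auto intro!: linearI simp: algebra_simps)
  qed (use cont y v_G in auto)
  then show ?thesis using y G_image by (simp add: has_field_derivative_def)
qed

text \<open>By \<open>v_deriv\<close> this is v', the second derivative of the function
  \<open>f\<close> introduced below.\<close>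

definition d :: "real \<Rightarrow> real" where "d z = slope (v z)"

lemma v_continuous: "continuous_on {0..b} v"
  by (rule DERIV_continuous_on[OF v_deriv])

lemma d_continuous: "continuous_on {0..b} d"
proof -
  have "continuous_on {0..p} slope" unfolding slope_def by (intro continuous_intros phi_continuous)
  then show ?thesis unfolding d_def
    by (rule continuous_on_compose2[OF _ v_continuous]) (use v_range in auto)
qed

lemma v_lipschitz: "\<exists>K\<ge>0. \<forall>z\<in>{0..b}. \<forall>z'\<in>{0..b}. \<bar>v z' - v z\<bar> \<le> K * \<bar>z' - z\<bar>"
proof -
  obtain K where K: "\<And>z. z \<in> {0..b} \<Longrightarrow> \<bar>d z\<bar> \<le> K"
    using compact_imp_bounded[OF compact_continuous_image[OF d_continuous compact_Icc]]
    unfolding bounded_real by blast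
  have "\<bar>v z' - v z\<bar> \<le> K * \<bar>z' - z\<bar>" if "z \<in> {0..b}" "z' \<in> {0..b}" for z z'
  proof -
    have "norm (v z' - v z) \<le> K * norm (z' - z)"
    proof (rule field_differentiable_bound[of "{0..b}" v d K z' z])
      show "(v has_real_derivative d w) (at w within {0..b})" if "w \<in> {0..b}" for w
        using v_deriv[OF that] by (simp only: d_def)
    qed (use K that in simp_all)
    then show ?thesis by simp
  qed
  moreover have "K \<ge> 0" using K[of 0] b_pos by auto
  ultimately show ?thesis by blast
qed

text \<open>A composition of Lipschitz maps. It replaces a bound on f''', which may fail to exist
  where \<open>phi\<close> has a kink.\<close>

lemma d_lipschitz: "\<exists>K\<ge>0. \<forall>z\<in>{0..b}. \<forall>z'\<in>{0..b}. \<bar>d z' - d z\<bar> \<le> K * \<bar>z' - z\<bar>"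
proof -
  obtain K where K: "K \<ge> 0" "\<And>z z'. z \<in> {0..b} \<Longrightarrow> z' \<in> {0..b} \<Longrightarrow> \<bar>v z' - v z\<bar> \<le> K * \<bar>z' - z\<bar>"
    using v_lipschitz by blast
  define k where "k = 2 / \<sigma>\<^sup>2"
  have k: "k \<ge> 0" by (simp add: k_def)
  have "\<bar>d z' - d z\<bar> \<le> (k * (lip * K)) * \<bar>z' - z\<bar>" if z: "z \<in> {0..b}" "z' \<in> {0..b}" for z z'
  proof -
    have "\<bar>d z' - d z\<bar> = k * \<bar>phi A c (v z') - phi A c (v z)\<bar>"
      using k unfolding d_def slope_def k_def[symmetric] by (simp add: abs_mult flip: right_diff_distrib)
    also have "\<dots> \<le> k * (lip * \<bar>v z' - v z\<bar>)"
      using k phi_lipschitz v_range z by (intro mult_left_mono) auto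
    also have "\<dots> \<le> k * (lip * (K * \<bar>z' - z\<bar>))"
      using k lip_pos K z by (intro mult_left_mono) auto
    finally show ?thesis by (simp add: mult.assoc)
  qed
  moreover have "k * (lip * K) \<ge> 0" using k lip_pos K by simp
  ultimately show ?thesis by blast
qed

section \<open>The relative value function: Taylor expansion and optimality inequality\<close>

definition f :: "real \<Rightarrow> real" where "f z = integral {0..z} v"

lemma f_deriv: "z \<in> {0..b} \<Longrightarrow> (f has_real_derivative v z) (at z within {0..b})"
  unfolding f_def by (rule integral_has_real_derivative[OF v_continuous])

lemma f_continuous: "continuous_on {0..b} f"
  by (rule DERIV_continuous_on[OF f_deriv])

text \<open>The mean value bound is applied twice: to \<open>v\<close> minus its tangent, using that
  \<open>d\<close> is Lipschitz, and then to \<open>f\<close> minus its quadratic expansion. The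
  cubic remainder follows without a third derivative.\<close>

lemma f_taylor:
  "\<exists>K\<ge>0. \<forall>z\<in>{0..b}. \<forall>z'\<in>{0..b}.
     \<bar>f z' - f z - v z * (z' - z) - d z / 2 * (z' - z)\<^sup>2\<bar> \<le> K * \<bar>z' - z\<bar> * (z' - z)\<^sup>2"
proof -
  obtain K where K: "K \<ge> 0" "\<And>z z'. z \<in> {0..b} \<Longrightarrow> z' \<in> {0..b} \<Longrightarrow> \<bar>d z' - d z\<bar> \<le> K * \<bar>z' - z\<bar>"
    using d_lipschitz by blast
  have "\<bar>f z' - f z - v z * (z' - z) - d z / 2 * (z' - z)\<^sup>2\<bar> \<le> K * \<bar>z' - z\<bar> * (z' - z)\<^sup>2"
    if z: "z \<in> {0..b}" "z' \<in> {0..b}" for z z'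
  proof -
    \<comment> \<open>A closed segment treats z \<le> z' and z' \<le> z at once.\<close>
    define S where "S = closed_segment z z'"
    have S: "S \<subseteq> {0..b}" "convex S" "z \<in> S" "z' \<in> S" "\<And>x. x \<in> S \<Longrightarrow> \<bar>x - z\<bar> \<le> \<bar>z' - z\<bar>"
      using z by (auto simp: S_def closed_segment_eq_real_ivl split: if_splits)
    have v1: "\<bar>v x - v z - d z * (x - z)\<bar> \<le> K * \<bar>z' - z\<bar> * \<bar>z' - z\<bar>" if x: "x \<in> S" for x
    proof -
      have "norm ((v x - d z * x) - (v z - d z * z)) \<le> (K * \<bar>z' - z\<bar>) * norm (x - z)"
      proof (rule field_differentiable_bound[of S "\<lambda>x. v x - d z * x" "\<lambda>x. d x - d z"])
        fix w assume w: "w \<in> S"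
        have "(v has_real_derivative d w) (at w within S)"
          using v_deriv[of w] w S(1) unfolding d_def by (meson has_field_derivative_subset subsetD)
        then show "((\<lambda>x. v x - d z * x) has_real_derivative d w - d z) (at w within S)"
          by (auto intro!: derivative_eq_intros)
        have "\<bar>d w - d z\<bar> \<le> K * \<bar>w - z\<bar>" using K(2)[OF z(1), of w] w S by auto
        also have "\<dots> \<le> K * \<bar>z' - z\<bar>" using K(1) S(5)[OF w] by (intro mult_left_mono)
        finally show "norm (d w - d z) \<le> K * \<bar>z' - z\<bar>" by simp
      qed (use S x in auto)
      also have "\<dots> \<le> (K * \<bar>z' - z\<bar>) * \<bar>z' - z\<bar>" using K(1) S(5)[OF x] by (intro mult_left_mono) auto
      finally show ?thesis by (simp add: algebra_simps)
    qed
    let ?q = "\<lambda>x. f x - v z * x - d z / 2 * (x - z)\<^sup>2"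
    have "norm (?q z' - ?q z) \<le> (K * \<bar>z' - z\<bar> * \<bar>z' - z\<bar>) * norm (z' - z)"
    proof (rule field_differentiable_bound[of S ?q "\<lambda>x. v x - v z - d z * (x - z)"])
      fix w assume w: "w \<in> S"
      have "(f has_real_derivative v w) (at w within S)"
        using f_deriv[of w] w S(1) by (meson has_field_derivative_subset subsetD)
      then show "(?q has_real_derivative v w - v z - d z * (w - z)) (at w within S)"
        by (auto intro!: derivative_eq_intros simp: algebra_simps diff_divide_distrib)
    qed (use S v1 in auto)
    then show ?thesis by (simp add: algebra_simps power2_eq_square abs_mult)
  qed
  then show ?thesis using K(1) by blast
qed

lemma v_ode: "\<sigma>\<^sup>2 / 2 * d z = phi A c (v z) + gam"
  using sigma_pos by (simp add: d_def slope_def)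

text \<open>Fenchel's inequality phi (v z) \<ge> x v z - c x, inserted into the differential
  equation for \<open>v\<close>. Equality holds at the maximizer, which is how the candidate policy
  is chosen.\<close>

lemma hjb_ineq:
  assumes "z \<in> {0..b}" "x \<in> A"
  shows "gam \<le> \<sigma>\<^sup>2 / 2 * d z - x * v z + c x"
  using phi_ge[OF v_range[OF assms(1)] assms(2)] unfolding v_ode by (simp add: mult.commute)

lemma hjb_eq:
  assumes "z \<in> {0..b}"
  shows "gam = \<sigma>\<^sup>2 / 2 * d z - cand_policy A c \<sigma> b p z * v z + c (cand_policy A c \<sigma> b p z)"
  using phi_psi[OF v_range[OF assms]] unfolding v_ode by (simp add: cand_policy_def mult.commute)

lemma cand_admissible: "admissible A b (cand_policy A c \<sigma> b p)"
proof -
  have "mono_on {0..b} (cand_policy A c \<sigma> b p)"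
    unfolding cand_policy_def by (intro mono_onI psi_mono v_mono v_range)
  then have "cand_policy A c \<sigma> b p \<in> borel_measurable (restrict_space borel {0..b})"
    by (rule borel_measurable_mono_on_fnc)
  moreover have "bounded (cand_policy A c \<sigma> b p ` {0..b})"
    unfolding bounded_real cand_policy_def using psi_abs_le v_range by blast
  ultimately show ?thesis
    unfolding admissible_def using psi_in v_range by (auto simp: cand_policy_def)
qed

end

section \<open>A pathwise Ito formula along dyadic partitions\<close>

definition dyad :: "real \<Rightarrow> nat \<Rightarrow> nat \<Rightarrow> real" where "dyad T n i = T * real i / 2 ^ n"

lemma dyad_0 [simp]: "dyad T n 0 = 0" and dyad_top [simp]: "dyad T n (2 ^ n) = T"
  by (auto simp: dyad_def)

lemma dyad_Suc: "dyad T n (Suc i) = dyad T n i + T / 2 ^ n"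
  by (simp add: dyad_def field_simps)

lemma dyad_mono: "0 \<le> T \<Longrightarrow> i \<le> j \<Longrightarrow> dyad T n i \<le> dyad T n j"
  by (simp add: dyad_def divide_right_mono mult_left_mono)

lemma dyad_range: "0 \<le> T \<Longrightarrow> i \<le> 2 ^ n \<Longrightarrow> dyad T n i \<in> {0..T}"
  using dyad_mono[of T 0 i n] dyad_mono[of T i "2 ^ n" n] by simp

lemma dyad_refine: "m \<le> n \<Longrightarrow> dyad T n (k * 2 ^ (n - m)) = dyad T m k"
  using power_add[of "2::real" m "n - m"] by (simp add: dyad_def)

text \<open>Uniform continuity, phrased with left endpoints: the sums must be nonanticipating for
  the martingale property to apply to them.\<close>

lemma dyad_oscillation:
  fixes g :: "real \<Rightarrow> real"
  assumes "0 \<le> T" "continuous_on {0..T} g" "e > 0"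
  shows "\<forall>\<^sub>F n in sequentially. \<forall>i<2 ^ n. \<forall>s\<in>{dyad T n i..dyad T n (Suc i)}. \<bar>g s - g (dyad T n i)\<bar> < e"
proof -
  have "uniformly_continuous_on {0..T} g"
    using assms(2) compact_Icc by (rule compact_uniformly_continuous)
  then obtain r where r: "r > 0" "\<And>x y. x \<in> {0..T} \<Longrightarrow> y \<in> {0..T} \<Longrightarrow> dist y x < r \<Longrightarrow> dist (g y) (g x) < e"
    unfolding uniformly_continuous_on_def using assms(3) by metis
  have "(\<lambda>n. T * (1 / 2) ^ n) \<longlonglongrightarrow> T * 0"
    by (intro tendsto_mult tendsto_const LIMSEQ_power_zero) auto
  then have "\<forall>\<^sub>F n in sequentially. T * (1 / 2) ^ n < r"
    using r(1) by (intro order_tendstoD) auto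
  then show ?thesis
  proof eventually_elim
    case (elim n)
    show ?case
    proof (intro allI impI ballI)
      fix i s assume i: "i < 2 ^ n" and s: "s \<in> {dyad T n i..dyad T n (Suc i)}"
      have "dyad T n i \<in> {0..T}" "dyad T n (Suc i) \<in> {0..T}"
        using i assms(1) by (auto intro!: dyad_range simp del: atLeastAtMost_iff)
      then show "\<bar>g s - g (dyad T n i)\<bar> < e"
        using r(2)[of "dyad T n i" s] s elim dyad_Suc[of T n i]
        by (auto simp: dist_real_def power_one_over)
    qed
  qed
qed

text \<open>The common pattern of all error estimates below: each error is a small factor, coming
  from an oscillation, times a weight of bounded total. The weights will be mesh sizes, increments
  of monotone paths, or squared increments.\<close>

lemma sum_tendsto_0_if_small_weights:
  fixes a w :: "nat \<Rightarrow> nat \<Rightarrow> real"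
  assumes w: "\<And>n. \<forall>i<2 ^ n. 0 \<le> w n i" and B: "Bseq (\<lambda>n. \<Sum>i<2 ^ n. w n i)"
    and small: "\<And>e. e > 0 \<Longrightarrow> \<forall>\<^sub>F n in sequentially. \<forall>i<2 ^ n. \<bar>a n i\<bar> \<le> e * w n i"
  shows "(\<lambda>n. \<Sum>i<2 ^ n. a n i) \<longlonglongrightarrow> 0"
proof (rule tendstoI)
  fix e :: real assume e: "e > 0"
  obtain C where C: "C > 0" "\<And>n. norm (\<Sum>i<2 ^ n. w n i) \<le> C" using B by (auto elim: BseqE)
  have "e / (2 * C) > 0" using e C by simp
  from small[OF this] show "\<forall>\<^sub>F n in sequentially. dist (\<Sum>i<2 ^ n. a n i) 0 < e"
  proof eventually_elim
    case (elim n)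
    have "\<bar>\<Sum>i<2 ^ n. a n i\<bar> \<le> (\<Sum>i<2 ^ n. e / (2 * C) * w n i)"
      by (rule order_trans[OF sum_abs]) (use elim in \<open>auto intro!: sum_mono\<close>)
    also have "\<dots> = e / (2 * C) * (\<Sum>i<2 ^ n. w n i)" by (simp add: sum_distrib_left)
    also have "\<dots> \<le> e / (2 * C) * C" using e C(1) C(2)[of n] by (intro mult_left_mono) auto
    also have "\<dots> < e" using e C by simp
    finally show ?case by (simp add: dist_real_def)
  qed
qed

lemma sum_dyad_telescope:
  fixes g :: "real \<Rightarrow> real"
  shows "(\<Sum>i<2 ^ n. g (dyad T n (Suc i)) - g (dyad T n i)) = g T - g 0"
  using sum_lessThan_telescope[of "\<lambda>i. g (dyad T n i)" "2 ^ n"] by simp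

lemma integral_dyad_split:
  fixes h :: "real \<Rightarrow> real"
  assumes "0 \<le> T" "h integrable_on {0..T}"
  shows "integral {0..T} h = (\<Sum>i<2 ^ n. integral {dyad T n i..dyad T n (Suc i)} h)"
proof -
  have "j \<le> 2 ^ n \<Longrightarrow> integral {0..dyad T n j} h = (\<Sum>i<j. integral {dyad T n i..dyad T n (Suc i)} h)" for j
  proof (induction j)
    case (Suc j)
    have "integral {0..dyad T n j} h + integral {dyad T n j..dyad T n (Suc j)} h = integral {0..dyad T n (Suc j)} h"
      using assms dyad_mono[of T 0 j n] dyad_mono[of T j "Suc j" n] dyad_range[of T "Suc j" n] Suc.prems
      by (intro Henstock_Kurzweil_Integration.integral_combine integrable_on_subinterval[OF assms(2)]) auto
    then show ?case using Suc by simp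
  qed simp
  from this[of "2 ^ n"] show ?thesis by simp
qed

lemma dyad_subset: "0 \<le> T \<Longrightarrow> i < 2 ^ n \<Longrightarrow> {dyad T n i..dyad T n (Suc i)} \<subseteq> {0..T}"
  using dyad_range[of T i n] dyad_range[of T "Suc i" n] by auto

text \<open>Only \<open>g\<close> is frozen at grid points. The function \<open>h\<close> will be
  the drift along a path, bounded but possibly discontinuous, so it has to be integrated over each
  grid interval rather than sampled.\<close>

lemma riemann_sum_dyad:
  fixes g h :: "real \<Rightarrow> real"
  assumes T: "0 \<le> T" and g: "continuous_on {0..T} g" and h: "h integrable_on {0..T}"
    and K: "\<And>s. s \<in> {0..T} \<Longrightarrow> \<bar>h s\<bar> \<le> K" and gh: "(\<lambda>s. g s * h s) integrable_on {0..T}"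
  shows "(\<lambda>n. \<Sum>i<2 ^ n. g (dyad T n i) * integral {dyad T n i..dyad T n (Suc i)} h)
    \<longlonglongrightarrow> integral {0..T} (\<lambda>s. g s * h s)"
proof -
  have K0: "K \<ge> 0" using K[of 0] T by auto
  let ?I = "\<lambda>n i. {dyad T n i..dyad T n (Suc i)}"
  let ?a = "\<lambda>n i. g (dyad T n i) * integral (?I n i) h - integral (?I n i) (\<lambda>s. g s * h s)"
  have "(\<lambda>n. \<Sum>i<2 ^ n. ?a n i) \<longlonglongrightarrow> 0"
  proof (rule sum_tendsto_0_if_small_weights[where w = "\<lambda>n i. K * T / 2 ^ n"])
    show "Bseq (\<lambda>n. \<Sum>i<(2::nat) ^ n. K * T / 2 ^ n)" by simp
    fix e :: real assume e: "e > 0"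
    from dyad_oscillation[OF T g e]
    show "\<forall>\<^sub>F n in sequentially. \<forall>i<2 ^ n. \<bar>?a n i\<bar> \<le> e * (K * T / 2 ^ n)"
    proof eventually_elim
      case (elim n)
      show ?case
      proof (intro allI impI)
        fix i :: nat assume i: "i < 2 ^ n"
        note sub = dyad_subset[OF T i]
        have ih: "h integrable_on ?I n i" "(\<lambda>s. g s * h s) integrable_on ?I n i"
          using integrable_on_subinterval[OF h sub] integrable_on_subinterval[OF gh sub] by auto
        have ii: "(\<lambda>s. g (dyad T n i) * h s - g s * h s) integrable_on ?I n i"
          by (intro integrable_diff integrable_on_mult_right ih)
        have "?a n i = integral (?I n i) (\<lambda>s. g (dyad T n i) * h s - g s * h s)"
          using ih by (simp add: integral_diff integrable_on_mult_right)
        then have "\<bar>?a n i\<bar> = norm (integral (?I n i) (\<lambda>s. g (dyad T n i) * h s - g s * h s))" by simp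
        also have "\<dots> \<le> integral (?I n i) (\<lambda>_. e * K)"
        proof (rule integral_norm_bound_integral[OF ii integrable_const_ivl])
          fix s assume s: "s \<in> ?I n i"
          have "\<bar>g s - g (dyad T n i)\<bar> * \<bar>h s\<bar> \<le> e * K"
            using elim i s e K[of s] sub K0 by (intro mult_mono) (auto intro: less_imp_le)
          then show "norm (g (dyad T n i) * h s - g s * h s) \<le> e * K"
            by (simp add: abs_mult abs_minus_commute flip: left_diff_distrib)
        qed
        also have "\<dots> = e * (K * T / 2 ^ n)"
          using T by (simp add: dyad_Suc)
        finally show "\<bar>?a n i\<bar> \<le> e * (K * T / 2 ^ n)" .
      qed
    qed
  qed (use K0 T in auto)
  then have "(\<lambda>n. (\<Sum>i<2 ^ n. ?a n i) + integral {0..T} (\<lambda>s. g s * h s)) \<longlonglongrightarrow> 0 + integral {0..T} (\<lambda>s. g s * h s)"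
    by (intro tendsto_add tendsto_const)
  then show ?thesis
    using integral_dyad_split[OF T gh] by (simp add: sum_subtractf)
qed

text \<open>A Stieltjes integral of \<open>g\<close> against a path that increases only where g = k,
  computed without Stieltjes integration: on each grid interval either \<open>l\<close> does not
  move or \<open>g\<close> hits \<open>k\<close>, so its left endpoint value is within one
  oscillation of \<open>k\<close>.\<close>

lemma boundary_sum_dyad:
  fixes g l :: "real \<Rightarrow> real"
  assumes T: "0 \<le> T" and g: "continuous_on {0..T} g" and l: "mono_on {0..T} l"
    and flat: "\<And>s t. 0 \<le> s \<Longrightarrow> s < t \<Longrightarrow> t \<le> T \<Longrightarrow> (\<And>r. r \<in> {s<..t} \<Longrightarrow> g r \<noteq> k) \<Longrightarrow> l t = l s"
  shows "(\<lambda>n. \<Sum>i<2 ^ n. g (dyad T n i) * (l (dyad T n (Suc i)) - l (dyad T n i))) \<longlonglongrightarrow> k * (l T - l 0)"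
proof -
  let ?dl = "\<lambda>n i. l (dyad T n (Suc i)) - l (dyad T n i)"
  have dl: "0 \<le> ?dl n i" if "i < 2 ^ n" for n i
    using dyad_range[OF T, of i n] dyad_range[OF T, of "Suc i" n] dyad_mono[OF T, of i "Suc i" n] that
    by (auto intro!: mono_onD[OF l])
  have "(\<lambda>n. \<Sum>i<2 ^ n. (g (dyad T n i) - k) * ?dl n i) \<longlonglongrightarrow> 0"
  proof (rule sum_tendsto_0_if_small_weights[where w = ?dl])
    show "Bseq (\<lambda>n. \<Sum>i<2 ^ n. ?dl n i)" by (simp add: sum_dyad_telescope)
    fix e :: real assume "e > 0"
    from dyad_oscillation[OF T g this]
    show "\<forall>\<^sub>F n in sequentially. \<forall>i<2 ^ n. \<bar>(g (dyad T n i) - k) * ?dl n i\<bar> \<le> e * ?dl n i"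
    proof eventually_elim
      case (elim n)
      show ?case
      proof (intro allI impI)
        fix i :: nat assume i: "i < 2 ^ n"
        show "\<bar>(g (dyad T n i) - k) * ?dl n i\<bar> \<le> e * ?dl n i"
        proof (cases "?dl n i = 0")
          case False
          have "dyad T n i < dyad T n (Suc i)"
            using False dyad_mono[OF T, of i "Suc i" n] by (cases "dyad T n i = dyad T n (Suc i)") auto
          moreover have "0 \<le> dyad T n i" "dyad T n (Suc i) \<le> T"
            using dyad_range[OF T, of i n] dyad_range[OF T, of "Suc i" n] i by auto
          ultimately obtain r where r: "r \<in> {dyad T n i<..dyad T n (Suc i)}" "g r = k"
            using flat[of "dyad T n i" "dyad T n (Suc i)"] False by auto
          then have "\<bar>g r - g (dyad T n i)\<bar> < e" using elim i by auto
          then have "\<bar>g (dyad T n i) - k\<bar> \<le> e" using r(2) by auto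
          then show ?thesis using dl[OF i] by (simp add: abs_mult mult_right_mono)
        qed simp
      qed
    qed
  qed (use dl in auto)
  then have "(\<lambda>n. (\<Sum>i<2 ^ n. (g (dyad T n i) - k) * ?dl n i) + k * (l T - l 0)) \<longlonglongrightarrow> 0 + k * (l T - l 0)"
    by (intro tendsto_add tendsto_const)
  moreover have "(\<Sum>i<2 ^ n. (g (dyad T n i) - k) * ?dl n i) + k * (l T - l 0)
      = (\<Sum>i<2 ^ n. g (dyad T n i) * ?dl n i)" for n
    unfolding sum_dyad_telescope[symmetric, of l T n] sum_distrib_left sum.distrib[symmetric]
    by (simp add: algebra_simps)
  ultimately show ?thesis by simp
qed

section \<open>Quadratic variation along dyadic blocks\<close>

definition block :: "nat \<Rightarrow> nat \<Rightarrow> nat \<Rightarrow> nat set" where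
  "block m n k = {k * 2 ^ (n - m)..<k * 2 ^ (n - m) + 2 ^ (n - m)}"

lemma sum_blocks: "m \<le> n \<Longrightarrow> (\<Sum>k<2 ^ m. sum a (block m n k)) = sum a {..<2 ^ n}"
  using sum.nat_group[of a "2 ^ (n - m)" "2 ^ m"] by (simp add: block_def flip: power_add)

text \<open>The parameter \<open>s\<close> is the variance per unit time. Convergence is demanded on
  every dyadic subinterval, not only on [0,T], so that varying weights can be integrated; these are
  countably many conditions, so they can hold simultaneously almost surely.\<close>

definition dyadic_qv :: "real \<Rightarrow> (real \<Rightarrow> real) \<Rightarrow> real \<Rightarrow> bool" where
  "dyadic_qv T x s \<longleftrightarrow> (\<forall>m. \<forall>k<2 ^ m.
     (\<lambda>n. \<Sum>i\<in>block m n k. (x (dyad T n (Suc i)) - x (dyad T n i))\<^sup>2) \<longlonglongrightarrow> s * T / 2 ^ m)"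

lemma block_mem:
  assumes "m \<le> n" "k < 2 ^ m" "i \<in> block m n k" "0 \<le> T"
  shows "i < 2 ^ n" "dyad T n i \<in> {dyad T m k..dyad T m (Suc k)}"
proof -
  have i: "k * 2 ^ (n - m) \<le> i" "i < Suc k * 2 ^ (n - m)" using assms(3) by (auto simp: block_def)
  have "Suc k * 2 ^ (n - m) \<le> (2::nat) ^ m * 2 ^ (n - m)" using assms(2) by (intro mult_right_mono) auto
  also have "\<dots> = 2 ^ n" using assms(1) by (simp flip: power_add)
  finally show "i < 2 ^ n" using i by linarith
  show "dyad T n i \<in> {dyad T m k..dyad T m (Suc k)}"
    using dyad_mono[OF assms(4) i(1), of n] dyad_mono[OF assms(4) less_imp_le[OF i(2)], of n]
      dyad_refine[OF assms(1), of T k] dyad_refine[OF assms(1), of T "Suc k"] by auto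
qed

text \<open>Freeze \<open>g\<close> on the intervals of a coarse level m, let n tend to infinity
  inside each block, and compare the result with the Riemann sum of \<open>g\<close> at level m.
  Each of the three errors is at most e/3.\<close>

lemma dyadic_qv_weighted:
  fixes g x :: "real \<Rightarrow> real"
  assumes T: "0 \<le> T" and g: "continuous_on {0..T} g" and qv: "dyadic_qv T x s"
  shows "(\<lambda>n. \<Sum>i<2 ^ n. g (dyad T n i) * (x (dyad T n (Suc i)) - x (dyad T n i))\<^sup>2)
    \<longlonglongrightarrow> s * integral {0..T} g"
proof (rule tendstoI)
  fix e :: real assume e: "e > 0"
  define a where "a n i = (x (dyad T n (Suc i)) - x (dyad T n i))\<^sup>2" for n i
  have a0: "0 \<le> a n i" for n i by (simp add: a_def)
  have block_lim: "(\<lambda>n. sum (a n) (block m n k)) \<longlonglongrightarrow> s * T / 2 ^ m" if "k < 2 ^ m" for m k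
    using qv that unfolding dyadic_qv_def a_def by blast
  have total: "(\<lambda>n. \<Sum>i<2 ^ n. a n i) \<longlonglongrightarrow> s * T"
    using block_lim[of 0 0] by (simp add: block_def atLeast0LessThan)
  \<comment> \<open>The sum of all squared increments is eventually below \<bar>s T\<bar> + 1, so
    replacing \<open>g\<close> by its block value costs at most e/3.\<close>
  define e' where "e' = e / (3 * (\<bar>s * T\<bar> + 1))"
  have e': "e' > 0" using e by (simp add: e'_def add_nonneg_pos)
  have "(\<lambda>n. \<Sum>i<2 ^ n. g (dyad T n i) * integral {dyad T n i..dyad T n (Suc i)} (\<lambda>_. 1))
      \<longlonglongrightarrow> integral {0..T} (\<lambda>s. g s * 1)"
    using g by (intro riemann_sum_dyad[where K = 1] T) (auto intro: integrable_continuous_real)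
  then have "(\<lambda>n. s * (\<Sum>i<2 ^ n. g (dyad T n i) * (T / 2 ^ n))) \<longlonglongrightarrow> s * integral {0..T} g"
    using T by (intro tendsto_mult tendsto_const) (simp add: dyad_Suc)
  then have "\<forall>\<^sub>F n in sequentially. dist (s * (\<Sum>i<2 ^ n. g (dyad T n i) * (T / 2 ^ n))) (s * integral {0..T} g) < e / 3"
    using e by (intro tendstoD) auto
  then have "\<forall>\<^sub>F m in sequentially. dist (s * (\<Sum>i<2 ^ m. g (dyad T m i) * (T / 2 ^ m))) (s * integral {0..T} g) < e / 3
      \<and> (\<forall>i<2 ^ m. \<forall>s\<in>{dyad T m i..dyad T m (Suc i)}. \<bar>g s - g (dyad T m i)\<bar> < e')"
    using dyad_oscillation[OF T g e'] by (rule eventually_conj)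
  \<comment> \<open>The coarse level is fixed from here on; only n varies, and only finitely many
    block limits are involved.\<close>
  then obtain m where m: "dist (s * (\<Sum>i<2 ^ m. g (dyad T m i) * (T / 2 ^ m))) (s * integral {0..T} g) < e / 3"
    "\<And>i s. i < 2 ^ m \<Longrightarrow> s \<in> {dyad T m i..dyad T m (Suc i)} \<Longrightarrow> \<bar>g s - g (dyad T m i)\<bar> < e'"
    unfolding eventually_sequentially by blast
  have "(\<lambda>n. \<Sum>k<2 ^ m. g (dyad T m k) * sum (a n) (block m n k)) \<longlonglongrightarrow> (\<Sum>k<2 ^ m. g (dyad T m k) * (s * T / 2 ^ m))"
    by (intro tendsto_sum tendsto_mult tendsto_const block_lim) auto
  then have "\<forall>\<^sub>F n in sequentially. dist (\<Sum>k<2 ^ m. g (dyad T m k) * sum (a n) (block m n k)) (\<Sum>k<2 ^ m. g (dyad T m k) * (s * T / 2 ^ m)) < e / 3"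
    using e by (intro tendstoD) auto
  moreover have "\<forall>\<^sub>F n in sequentially. dist (\<Sum>i<2 ^ n. a n i) (s * T) < 1"
    using total by (rule tendstoD) simp
  ultimately show "\<forall>\<^sub>F n in sequentially. dist (\<Sum>i<2 ^ n. g (dyad T n i) * (x (dyad T n (Suc i)) - x (dyad T n i))\<^sup>2) (s * integral {0..T} g) < e"
    using eventually_ge_at_top[of m]
  proof eventually_elim
    case (elim n)
    have "(\<Sum>i<2 ^ n. g (dyad T n i) * a n i) - (\<Sum>k<2 ^ m. g (dyad T m k) * sum (a n) (block m n k))
        = (\<Sum>k<2 ^ m. \<Sum>i\<in>block m n k. (g (dyad T n i) - g (dyad T m k)) * a n i)"
      by (simp add: sum_blocks[OF elim(3), symmetric] sum_distrib_left left_diff_distrib sum_subtractf)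
    also have "\<bar>\<dots>\<bar> \<le> (\<Sum>k<2 ^ m. \<Sum>i\<in>block m n k. e' * a n i)"
    proof (intro order_trans[OF sum_abs] sum_mono)
      fix k i :: nat assume k: "k \<in> {..<2 ^ m}" and i: "i \<in> block m n k"
      have "\<bar>g (dyad T n i) - g (dyad T m k)\<bar> < e'"
        using block_mem(2)[OF elim(3) _ i T] k by (intro m(2)) auto
      then show "\<bar>(g (dyad T n i) - g (dyad T m k)) * a n i\<bar> \<le> e' * a n i"
        using a0[of n i] by (simp add: abs_mult mult_right_mono)
    qed
    also have "\<dots> = e' * (\<Sum>i<2 ^ n. a n i)"
      by (simp add: sum_blocks[OF elim(3)] flip: sum_distrib_left)
    also have "\<dots> \<le> e' * (\<bar>s * T\<bar> + 1)"
      using e' elim(2) by (intro mult_left_mono) (auto simp: dist_real_def)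
    also have "\<dots> = e / 3" by (simp add: e'_def field_simps)
    finally have 1: "\<bar>(\<Sum>i<2 ^ n. g (dyad T n i) * a n i) - (\<Sum>k<2 ^ m. g (dyad T m k) * sum (a n) (block m n k))\<bar> \<le> e / 3" .
    have "(\<Sum>k<2 ^ m. g (dyad T m k) * (s * T / 2 ^ m)) = s * (\<Sum>i<2 ^ m. g (dyad T m i) * (T / 2 ^ m))"
      by (simp add: sum_distrib_left algebra_simps)
    then show ?case
      using 1 elim(1) m(1) unfolding dist_real_def a_def[symmetric] by linarith
  qed
qed

context drift_control begin

text \<open>The pathwise Ito formula for \<open>f\<close>, with the stochastic integral realized as a limit of dyadic sums.
  The boundary terms are \<open>f' 0 = v 0 = 0\<close> for \<open>l\<close> and \<open>f' b = v b = p\<close> for \<open>u\<close>.\<close>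
lemma pathwise_ito:
  fixes x z l u h :: "real \<Rightarrow> real"
  assumes T: "0 \<le> T"
    and cont: "continuous_on {0..T} x" "continuous_on {0..T} z"
    and l: "mono_on {0..T} l" "l 0 = 0" and u: "mono_on {0..T} u" "u 0 = 0"
    and zr: "\<And>t. t \<in> {0..T} \<Longrightarrow> z t \<in> {0..b}"
    and eq: "\<And>t. t \<in> {0..T} \<Longrightarrow> z t = z0 + x t - integral {0..t} h + l t - u t"
    and lflat: "\<And>s t. 0 \<le> s \<Longrightarrow> s < t \<Longrightarrow> t \<le> T \<Longrightarrow> (\<And>r. r \<in> {s<..t} \<Longrightarrow> z r > 0) \<Longrightarrow> l t = l s"
    and uflat: "\<And>s t. 0 \<le> s \<Longrightarrow> s < t \<Longrightarrow> t \<le> T \<Longrightarrow> (\<And>r. r \<in> {s<..t} \<Longrightarrow> z r < b) \<Longrightarrow> u t = u s"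
    and h: "h integrable_on {0..T}" "\<And>s. s \<in> {0..T} \<Longrightarrow> \<bar>h s\<bar> \<le> H"
    and vh: "(\<lambda>s. v (z s) * h s) integrable_on {0..T}"
    and qv: "dyadic_qv T x (\<sigma>\<^sup>2)"
  shows "(\<lambda>n. \<Sum>i<2 ^ n. v (z (dyad T n i)) * (x (dyad T n (Suc i)) - x (dyad T n i)))
    \<longlonglongrightarrow> f (z T) - f (z 0) - \<sigma>\<^sup>2 / 2 * integral {0..T} (\<lambda>s. d (z s))
      + integral {0..T} (\<lambda>s. v (z s) * h s) + p * u T"
proof -
  let ?t = "dyad T"
  define dx where "dx n i = x (?t n (Suc i)) - x (?t n i)" for n i
  define dz where "dz n i = z (?t n (Suc i)) - z (?t n i)" for n i
  define dl where "dl n i = l (?t n (Suc i)) - l (?t n i)" for n i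
  define du where "du n i = u (?t n (Suc i)) - u (?t n i)" for n i
  define dh where "dh n i = integral {?t n i..?t n (Suc i)} h" for n i
  \<comment> \<open>Remainder of the second-order Taylor expansion over one grid interval.\<close>
  define R where "R n i = f (z (?t n (Suc i))) - f (z (?t n i)) - v (z (?t n i)) * dz n i - d (z (?t n i)) / 2 * (dz n i)\<^sup>2" for n i
  \<comment> \<open>Error of replacing squared increments of \<open>z\<close> by those of
    \<open>x\<close>. It factors as (dz + dx)(dz - dx): the first factor is small by continuity, the
    second is an increment of bounded variation.\<close>
  define E where "E n i = (dz n i)\<^sup>2 - (dx n i)\<^sup>2" for n i
  have H: "H \<ge> 0" using h(2)[of 0] T by auto
  have tr: "?t n i \<in> {0..T}" "?t n (Suc i) \<in> {0..T}" "?t n i \<le> ?t n (Suc i)" if "i < 2 ^ n" for n i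
    using dyad_range[OF T, of i n] dyad_range[OF T, of "Suc i" n] dyad_mono[OF T, of i "Suc i" n] that by auto
  have dl0: "0 \<le> dl n i" and du0: "0 \<le> du n i" if "i < 2 ^ n" for n i
    using tr[OF that] by (auto simp: dl_def du_def intro!: mono_onD[OF l(1)] mono_onD[OF u(1)])
  have dz_eq: "dz n i = dx n i - dh n i + dl n i - du n i" if i: "i < 2 ^ n" for n i
  proof -
    have "integral {0..?t n i} h + dh n i = integral {0..?t n (Suc i)} h"
      unfolding dh_def using tr[OF i]
      by (intro Henstock_Kurzweil_Integration.integral_combine integrable_on_subinterval[OF h(1)]) auto
    then show ?thesis using eq[OF tr(1)[OF i]] eq[OF tr(2)[OF i]]
      by (simp add: dz_def dx_def dl_def du_def)
  qed
  have dh_le: "\<bar>dh n i\<bar> \<le> H * T / 2 ^ n" if i: "i < 2 ^ n" for n i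
  proof -
    have "norm (dh n i) \<le> integral {?t n i..?t n (Suc i)} (\<lambda>_. H)"
      unfolding dh_def using tr[OF i] h(2)
      by (intro integral_norm_bound_integral integrable_on_subinterval[OF h(1)] integrable_const_ivl) auto
    also have "\<dots> = H * T / 2 ^ n" using T by (simp add: dyad_Suc)
    finally show ?thesis by simp
  qed
  have vz: "continuous_on {0..T} (\<lambda>s. v (z s))" and dzc: "continuous_on {0..T} (\<lambda>s. d (z s))"
    using zr by (auto intro!: continuous_on_compose2[OF v_continuous cont(2)] continuous_on_compose2[OF d_continuous cont(2)])
  \<comment> \<open>Half of \<open>w\<close> dominates \<bar>dz - dx\<bar>, while \<bar>dz +
    dx\<bar> is at most 2 e; hence \<bar>E\<bar> \<le> e w. The total of \<open>w\<close> telescopes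
    to a value independent of n.\<close>
  define w where "w n i = 2 * (H * T / 2 ^ n + dl n i + du n i)" for n i
  have w0: "0 \<le> w n i" if "i < 2 ^ n" for n i
    using H T dl0[OF that] du0[OF that] by (simp add: w_def)
  have sum_w: "(\<Sum>i<2 ^ n. w n i) = 2 * (H * T + l T + u T)" for n
    using sum_dyad_telescope[of l T n] sum_dyad_telescope[of u T n] l(2) u(2)
    unfolding w_def sum_distrib_left[symmetric] sum.distrib dl_def du_def by simp
  have E_small: "\<forall>\<^sub>F n in sequentially. \<forall>i<2 ^ n. \<bar>E n i\<bar> \<le> e * w n i" if "e > 0" for e
    using dyad_oscillation[OF T cont(1) that] dyad_oscillation[OF T cont(2) that]
  proof eventually_elim
    case (elim n)
    show ?case
    proof (intro allI impI)
      fix i :: nat assume i: "i < 2 ^ n"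
      have "\<bar>dx n i\<bar> < e" "\<bar>dz n i\<bar> < e" using elim i tr[OF i] unfolding dx_def dz_def by auto
      then have 1: "\<bar>dz n i + dx n i\<bar> \<le> 2 * e" by linarith
      have 2: "\<bar>dz n i - dx n i\<bar> \<le> w n i / 2"
      proof -
        have "w n i / 2 = H * T / 2 ^ n + dl n i + du n i" by (simp add: w_def)
        then show ?thesis using dz_eq[OF i] dh_le[OF i] dl0[OF i] du0[OF i] by linarith
      qed
      have "\<bar>E n i\<bar> = \<bar>dz n i + dx n i\<bar> * \<bar>dz n i - dx n i\<bar>"
        by (simp add: E_def abs_mult[symmetric] algebra_simps power2_eq_square)
      also have "\<dots> \<le> (2 * e) * (w n i / 2)"
        using that by (intro mult_mono 1 2) auto
      finally show "\<bar>E n i\<bar> \<le> e * w n i" by simp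
    qed
  qed
  have E_lim: "(\<lambda>n. \<Sum>i<2 ^ n. E n i) \<longlonglongrightarrow> 0"
    by (rule sum_tendsto_0_if_small_weights[OF _ _ E_small]) (auto simp: w0 sum_w)
  obtain D where D: "\<And>y. y \<in> {0..b} \<Longrightarrow> \<bar>d y\<bar> \<le> D"
    using compact_imp_bounded[OF compact_continuous_image[OF d_continuous compact_Icc]]
    unfolding bounded_real by blast
  have D0: "D \<ge> 0" using D[of 0] b_pos by auto
  have dE_lim: "(\<lambda>n. \<Sum>i<2 ^ n. d (z (?t n i)) * E n i) \<longlonglongrightarrow> 0"
  proof (rule sum_tendsto_0_if_small_weights[where w = "\<lambda>n i. D * w n i"])
    fix e :: real assume "e > 0"
    from E_small[OF this] show "\<forall>\<^sub>F n in sequentially. \<forall>i<2 ^ n. \<bar>d (z (?t n i)) * E n i\<bar> \<le> e * (D * w n i)"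
    proof eventually_elim
      case (elim n)
      show ?case
      proof (intro allI impI)
        fix i :: nat assume i: "i < 2 ^ n"
        have "\<bar>d (z (?t n i))\<bar> * \<bar>E n i\<bar> \<le> D * (e * w n i)"
          using elim i D zr tr(1)[OF i] D0 by (intro mult_mono) auto
        then show "\<bar>d (z (?t n i)) * E n i\<bar> \<le> e * (D * w n i)" by (simp add: abs_mult algebra_simps)
      qed
    qed
  qed (auto simp: D0 w0 sum_w simp flip: sum_distrib_left)
  have dx2_lim: "(\<lambda>n. \<Sum>i<2 ^ n. d (z (?t n i)) * (dx n i)\<^sup>2) \<longlonglongrightarrow> \<sigma>\<^sup>2 * integral {0..T} (\<lambda>s. d (z s))"
    unfolding dx_def by (rule dyadic_qv_weighted[OF T dzc qv])
  \<comment> \<open>Constant weight 1 gives the quadratic variation of \<open>x\<close>, hence that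
    of \<open>z\<close>; its boundedness makes the squares of dz usable as weights for
    \<open>R\<close>.\<close>
  have "(\<lambda>n. \<Sum>i<2 ^ n. 1 * (dx n i)\<^sup>2) \<longlonglongrightarrow> \<sigma>\<^sup>2 * integral {0..T} (\<lambda>s. 1)"
    unfolding dx_def by (rule dyadic_qv_weighted[OF T _ qv]) auto
  from tendsto_add[OF this E_lim]
  have dz2_lim: "convergent (\<lambda>n. \<Sum>i<2 ^ n. (dz n i)\<^sup>2)"
    by (auto simp: E_def sum_subtractf convergent_def)
  obtain K where K: "K \<ge> 0" "\<And>y y'. y \<in> {0..b} \<Longrightarrow> y' \<in> {0..b} \<Longrightarrow>
     \<bar>f y' - f y - v y * (y' - y) - d y / 2 * (y' - y)\<^sup>2\<bar> \<le> K * \<bar>y' - y\<bar> * (y' - y)\<^sup>2"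
    using f_taylor by blast
  have R_lim: "(\<lambda>n. \<Sum>i<2 ^ n. R n i) \<longlonglongrightarrow> 0"
  proof (rule sum_tendsto_0_if_small_weights[where w = "\<lambda>n i. K * (dz n i)\<^sup>2"])
    show "Bseq (\<lambda>n. \<Sum>i<2 ^ n. K * (dz n i)\<^sup>2)"
      unfolding sum_distrib_left[symmetric]
      using dz2_lim by (intro convergent_imp_Bseq convergent_mult convergent_const)
    fix e :: real assume "e > 0"
    from dyad_oscillation[OF T cont(2) this]
    show "\<forall>\<^sub>F n in sequentially. \<forall>i<2 ^ n. \<bar>R n i\<bar> \<le> e * (K * (dz n i)\<^sup>2)"
    proof eventually_elim
      case (elim n)
      show ?case
      proof (intro allI impI)
        fix i :: nat assume i: "i < 2 ^ n"
        have "\<bar>R n i\<bar> \<le> K * \<bar>dz n i\<bar> * (dz n i)\<^sup>2"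
          unfolding R_def dz_def using zr tr[OF i] by (intro K(2)) auto
        also have "\<dots> \<le> K * e * (dz n i)\<^sup>2"
          using elim i tr[OF i] K(1) unfolding dz_def
          by (intro mult_right_mono mult_left_mono) (auto intro: less_imp_le)
        finally show "\<bar>R n i\<bar> \<le> e * (K * (dz n i)\<^sup>2)" by (simp add: algebra_simps)
      qed
    qed
  qed (use K(1) in auto)
  have vh_lim: "(\<lambda>n. \<Sum>i<2 ^ n. v (z (?t n i)) * dh n i) \<longlonglongrightarrow> integral {0..T} (\<lambda>s. v (z s) * h s)"
    unfolding dh_def by (rule riemann_sum_dyad[OF T vz h vh])
  \<comment> \<open>Where v (z r) differs from its value at a barrier, \<open>z r\<close> is away
    from that barrier, so the flatness hypotheses apply.\<close>
  have zpos: "z r > 0" if "r \<in> {0..T}" "v (z r) \<noteq> 0" for r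
    using zr[OF that(1)] that(2) v_0 by (cases "z r = 0") auto
  have zb: "z r < b" if "r \<in> {0..T}" "v (z r) \<noteq> p" for r
    using zr[OF that(1)] that(2) v_b by (cases "z r = b") auto
  have vl_lim: "(\<lambda>n. \<Sum>i<2 ^ n. v (z (?t n i)) * dl n i) \<longlonglongrightarrow> 0 * (l T - l 0)"
    unfolding dl_def
    by (rule boundary_sum_dyad[OF T vz l(1)], rule lflat) (auto intro!: zpos)
  have vu_lim: "(\<lambda>n. \<Sum>i<2 ^ n. v (z (?t n i)) * du n i) \<longlonglongrightarrow> p * (u T - u 0)"
    unfolding du_def
    by (rule boundary_sum_dyad[OF T vz u(1)], rule uflat) (auto intro!: zb)
  \<comment> \<open>The Ito formula before the limit, an exact identity for each n: Taylor expansion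
    plus dz = dx - dh + dl - du. Every sum on the right has a known limit.\<close>
  have "(\<Sum>i<2 ^ n. v (z (?t n i)) * dx n i) = f (z T) - f (z 0) - (\<Sum>i<2 ^ n. R n i)
      - (\<Sum>i<2 ^ n. d (z (?t n i)) * (dx n i)\<^sup>2) / 2 - (\<Sum>i<2 ^ n. d (z (?t n i)) * E n i) / 2
      + (\<Sum>i<2 ^ n. v (z (?t n i)) * dh n i) - (\<Sum>i<2 ^ n. v (z (?t n i)) * dl n i)
      + (\<Sum>i<2 ^ n. v (z (?t n i)) * du n i)" for n
    unfolding sum_dyad_telescope[of "\<lambda>s. f (z s)" T n, symmetric] sum_divide_distrib
      sum_subtractf[symmetric] sum.distrib[symmetric]
  proof (rule sum.cong[OF refl])
    fix i :: nat assume "i \<in> {..<2 ^ n}"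
    then have i: "i < 2 ^ n" by simp
    have vdx: "v (z (?t n i)) * dx n i = v (z (?t n i)) * dz n i + v (z (?t n i)) * dh n i
        - v (z (?t n i)) * dl n i + v (z (?t n i)) * du n i"
      unfolding dz_eq[OF i] by (simp add: algebra_simps)
    show "v (z (?t n i)) * dx n i = f (z (?t n (Suc i))) - f (z (?t n i)) - R n i
        - d (z (?t n i)) * (dx n i)\<^sup>2 / 2 - d (z (?t n i)) * E n i / 2
        + v (z (?t n i)) * dh n i - v (z (?t n i)) * dl n i + v (z (?t n i)) * du n i"
      unfolding vdx R_def E_def by (simp add: algebra_simps diff_divide_distrib)
  qed
  moreover have "(\<lambda>n. f (z T) - f (z 0) - (\<Sum>i<2 ^ n. R n i)
      - (\<Sum>i<2 ^ n. d (z (?t n i)) * (dx n i)\<^sup>2) / 2 - (\<Sum>i<2 ^ n. d (z (?t n i)) * E n i) / 2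
      + (\<Sum>i<2 ^ n. v (z (?t n i)) * dh n i) - (\<Sum>i<2 ^ n. v (z (?t n i)) * dl n i)
      + (\<Sum>i<2 ^ n. v (z (?t n i)) * du n i))
    \<longlonglongrightarrow> f (z T) - f (z 0) - 0 - (\<sigma>\<^sup>2 * integral {0..T} (\<lambda>s. d (z s))) / 2 - 0 / 2
      + integral {0..T} (\<lambda>s. v (z s) * h s) - 0 * (l T - l 0) + p * (u T - u 0)"
    by (intro tendsto_intros R_lim dx2_lim dE_lim vh_lim vl_lim vu_lim) auto
  ultimately show ?thesis by (simp add: dx_def u(2))
qed

end

section \<open>Quadratic variation of Brownian motion and martingale transforms\<close>

lemma integrable_mult_of_squares:
  fixes f g :: "'a \<Rightarrow> real"
  assumes [measurable]: "f \<in> borel_measurable M" "g \<in> borel_measurable M"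
    and "integrable M (\<lambda>x. (f x)\<^sup>2)" "integrable M (\<lambda>x. (g x)\<^sup>2)"
  shows "integrable M (\<lambda>x. f x * g x)"
proof (rule Bochner_Integration.integrable_bound)
  show "integrable M (\<lambda>x. (f x)\<^sup>2 + (g x)\<^sup>2)" using assms by auto
  show "AE x in M. norm (f x * g x) \<le> norm ((f x)\<^sup>2 + (g x)\<^sup>2)"
  proof (intro AE_I2)
    fix x
    have "2 * (\<bar>f x\<bar> * \<bar>g x\<bar>) \<le> (f x)\<^sup>2 + (g x)\<^sup>2"
      using sum_squares_bound[of "\<bar>f x\<bar>" "\<bar>g x\<bar>"] by simp
    moreover have "0 \<le> \<bar>f x\<bar> * \<bar>g x\<bar>" by simp
    ultimately have "\<bar>f x\<bar> * \<bar>g x\<bar> \<le> (f x)\<^sup>2 + (g x)\<^sup>2" by linarith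
    then show "norm (f x * g x) \<le> norm ((f x)\<^sup>2 + (g x)\<^sup>2)" by (simp add: abs_mult)
  qed
qed simp

text \<open>The sum of the squares has finite expectation, so it is finite almost surely and its
  terms tend to 0.\<close>

lemma AE_tendsto_0_of_summable_second_moments:
  fixes D :: "nat \<Rightarrow> 'a \<Rightarrow> real"
  assumes [measurable]: "\<And>n. D n \<in> borel_measurable M"
    and int: "\<And>n. integrable M (\<lambda>x. (D n x)\<^sup>2)"
    and le: "\<And>n. (\<integral>x. (D n x)\<^sup>2 \<partial>M) \<le> r n" and r: "summable r"
  shows "AE x in M. (\<lambda>n. D n x) \<longlonglongrightarrow> 0"
proof -
  have r0: "0 \<le> r n" for n
    by (rule order_trans[OF Bochner_Integration.integral_nonneg le]) simp
  have "(\<integral>\<^sup>+x. (\<Sum>n. ennreal ((D n x)\<^sup>2)) \<partial>M) = (\<Sum>n. \<integral>\<^sup>+x. ennreal ((D n x)\<^sup>2) \<partial>M)"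
    by (rule nn_integral_suminf) simp
  also have "\<dots> \<le> (\<Sum>n. ennreal (r n))"
  proof (intro suminf_le allI)
    show "(\<integral>\<^sup>+x. ennreal ((D n x)\<^sup>2) \<partial>M) \<le> ennreal (r n)" for n
      using nn_integral_eq_integral[OF int[of n]] le[of n] by (simp add: ennreal_leI)
  qed auto
  also have "\<dots> = ennreal (\<Sum>n. r n)" using r r0 by (intro suminf_ennreal2) auto
  also have "\<dots> < top" by simp
  finally have "AE x in M. (\<Sum>n. ennreal ((D n x)\<^sup>2)) \<noteq> \<infinity>"
    by (intro nn_integral_noteq_infinite) auto
  then show ?thesis
  proof eventually_elim
    case (elim x)
    then have "summable (\<lambda>n. (D n x)\<^sup>2)" by (intro summable_suminf_not_top) auto
    then have "(\<lambda>n. (D n x)\<^sup>2) \<longlonglongrightarrow> 0" by (rule summable_LIMSEQ_zero)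
    from tendsto_real_sqrt[OF this] show "(\<lambda>n. D n x) \<longlonglongrightarrow> 0"
      by (simp add: tendsto_rabs_zero_iff)
  qed
qed

text \<open>Almost sure convergence alone does not preserve means. Boundedness in L^2 does, by
  uniform integrability: truncation at N moves every mean by at most a second moment divided by N,
  uniformly in n, and truncated means converge by dominated convergence.\<close>

lemma (in prob_space) L2_bounded_limit_centered:
  fixes S :: "nat \<Rightarrow> 'a \<Rightarrow> real"
  assumes [measurable]: "\<And>n. S n \<in> borel_measurable M" "Y \<in> borel_measurable M"
    and sq: "\<And>n. integrable M (\<lambda>x. (S n x)\<^sup>2)" and mean: "\<And>n. expectation (S n) = 0"
    and bound: "\<And>n. expectation (\<lambda>x. (S n x)\<^sup>2) \<le> C"
    and lim: "AE x in M. (\<lambda>n. S n x) \<longlonglongrightarrow> Y x"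
  shows "integrable M Y" "expectation Y = 0"
proof -
  have "(\<integral>\<^sup>+x. ennreal ((Y x)\<^sup>2) \<partial>M) = (\<integral>\<^sup>+x. liminf (\<lambda>n. ennreal ((S n x)\<^sup>2)) \<partial>M)"
  proof (rule nn_integral_cong_AE)
    show "AE x in M. ennreal ((Y x)\<^sup>2) = liminf (\<lambda>n. ennreal ((S n x)\<^sup>2))"
      using lim
    proof eventually_elim
      case (elim x)
      have "(\<lambda>n. ennreal ((S n x)\<^sup>2)) \<longlonglongrightarrow> ennreal ((Y x)\<^sup>2)"
        by (intro tendsto_ennrealI tendsto_power elim)
      then show ?case using lim_imp_Liminf[OF trivial_limit_sequentially] by metis
    qed
  qed
  also have "\<dots> \<le> liminf (\<lambda>n. \<integral>\<^sup>+x. ennreal ((S n x)\<^sup>2) \<partial>M)"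
    by (rule nn_integral_liminf) simp
  also have "\<dots> \<le> limsup (\<lambda>n. \<integral>\<^sup>+x. ennreal ((S n x)\<^sup>2) \<partial>M)"
    by (rule Liminf_le_Limsup) simp
  also have "\<dots> \<le> ennreal C"
  proof (intro Limsup_bounded always_eventually allI)
    show "(\<integral>\<^sup>+x. ennreal ((S n x)\<^sup>2) \<partial>M) \<le> ennreal C" for n
      using nn_integral_eq_integral[OF sq[of n]] bound[of n] by (simp add: ennreal_leI)
  qed
  finally have "(\<integral>\<^sup>+x. ennreal ((Y x)\<^sup>2) \<partial>M) < \<infinity>" by (simp add: le_less_trans)
  then have Y2: "integrable M (\<lambda>x. (Y x)\<^sup>2)" by (intro integrableI_bounded) auto
  then show Y: "integrable M Y" by (rule square_integrable_imp_integrable[rotated]) simp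
  have Sint: "integrable M (S n)" for n by (rule square_integrable_imp_integrable[OF _ sq]) simp
  define tr where "tr N x = max (- N) (min N x)" for N x :: real
  have [measurable]: "tr N \<in> borel_measurable borel" for N unfolding tr_def by measurable
  have tr: "\<bar>x - tr N x\<bar> \<le> x\<^sup>2 / N" "\<bar>tr N x\<bar> \<le> N" if "N > 0" for N x
  proof -
    show "\<bar>tr N x\<bar> \<le> N" using that by (auto simp: tr_def)
    show "\<bar>x - tr N x\<bar> \<le> x\<^sup>2 / N"
    proof (cases "\<bar>x\<bar> \<le> N")
      case True then show ?thesis using that by (auto simp: tr_def)
    next
      case False
      have "\<bar>x - tr N x\<bar> \<le> \<bar>x\<bar>" using False that by (auto simp: tr_def)
      also have "\<dots> \<le> x\<^sup>2 / N" using False that mult_mono[of N "\<bar>x\<bar>" "\<bar>x\<bar>" "\<bar>x\<bar>"]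
        by (simp add: pos_le_divide_eq power2_eq_square mult.commute flip: abs_mult)
      finally show ?thesis .
    qed
  qed
  have cut: "\<bar>expectation g - expectation (\<lambda>x. tr N (g x))\<bar> \<le> expectation (\<lambda>x. (g x)\<^sup>2) / N"
    if [measurable]: "g \<in> borel_measurable M" and g: "integrable M g" "integrable M (\<lambda>x. (g x)\<^sup>2)" and N: "N > 0" for g N
  proof -
    have t: "integrable M (\<lambda>x. tr N (g x))"
      by (rule integrable_const_bound[where B = N]) (use tr N in auto)
    have "\<bar>expectation g - expectation (\<lambda>x. tr N (g x))\<bar> = \<bar>expectation (\<lambda>x. g x - tr N (g x))\<bar>"
      using g t by simp
    also have "\<dots> \<le> expectation (\<lambda>x. \<bar>g x - tr N (g x)\<bar>)" by (rule integral_abs_bound)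
    also have "\<dots> \<le> expectation (\<lambda>x. (g x)\<^sup>2 / N)"
      using g t tr N by (intro integral_mono) auto
    finally show ?thesis by simp
  qed
  have small: "\<bar>expectation Y\<bar> \<le> (C + expectation (\<lambda>x. (Y x)\<^sup>2)) / N" if N: "N > 0" for N
  proof -
    have "(\<lambda>n. expectation (\<lambda>x. tr N (S n x))) \<longlonglongrightarrow> expectation (\<lambda>x. tr N (Y x))"
    proof (rule integral_dominated_convergence)
      show "AE x in M. (\<lambda>n. tr N (S n x)) \<longlonglongrightarrow> tr N (Y x)"
        using lim by eventually_elim (auto simp: tr_def intro!: tendsto_intros)
      show "AE x in M. norm (tr N (S n x)) \<le> N" for n using tr N by auto
    qed auto
    from tendsto_rabs[OF this] have "\<bar>expectation (\<lambda>x. tr N (Y x))\<bar> \<le> C / N"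
    proof (rule tendsto_upperbound)
      show "\<forall>\<^sub>F n in sequentially. \<bar>expectation (\<lambda>x. tr N (S n x))\<bar> \<le> C / N"
      proof (intro always_eventually allI)
        fix n
        have "\<bar>expectation (\<lambda>x. tr N (S n x))\<bar> \<le> expectation (\<lambda>x. (S n x)\<^sup>2) / N"
          using cut[of "S n" N] Sint sq N mean[of n] by simp
        also have "\<dots> \<le> C / N" using bound[of n] N by (simp add: divide_right_mono)
        finally show "\<bar>expectation (\<lambda>x. tr N (S n x))\<bar> \<le> C / N" .
      qed
    qed simp
    then show ?thesis using cut[of Y N] Y Y2 N by (simp add: add_divide_distrib)
  qed
  show "expectation Y = 0"
  proof (rule ccontr)
    assume "expectation Y \<noteq> 0"
    define q where "q = C + expectation (\<lambda>x. (Y x)\<^sup>2)"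
    \<comment> \<open>Makes \<bar>E Y\<bar> N equal to \<bar>q\<bar> + 1, contradicting the bound by
      \<open>q\<close>.\<close>
    define N where "N = (\<bar>q\<bar> + 1) / \<bar>expectation Y\<bar>"
    have N: "N > 0" using \<open>expectation Y \<noteq> 0\<close> by (simp add: N_def add_nonneg_pos)
    have "\<bar>expectation Y\<bar> * N \<le> q" using small[OF N] N by (simp add: q_def pos_le_divide_eq)
    moreover have "\<bar>expectation Y\<bar> * N = \<bar>q\<bar> + 1" using \<open>expectation Y \<noteq> 0\<close> by (simp add: N_def)
    ultimately show False by linarith
  qed
qed

section \<open>Brownian increments and almost sure quadratic variation\<close>

locale filtered_brownian = prob_space M for M :: "'w measure" +
  fixes F :: "real \<Rightarrow> 'w measure" and X :: "real \<Rightarrow> 'w \<Rightarrow> real" and \<sigma> :: real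
  assumes vol_pos: "\<sigma> > 0" and filt: "filtered_prob_space M F"
    and bm: "brownian_motion M \<sigma> X" and mart: "martingale M F X"
begin

lemma X_measurable [measurable]: "0 \<le> t \<Longrightarrow> X t \<in> borel_measurable M"
  using bm by (simp add: brownian_motion_def)

lemma increment_distributed: "0 \<le> s \<Longrightarrow> s < t \<Longrightarrow>
  distributed M lborel (\<lambda>\<omega>. X t \<omega> - X s \<omega>) (\<lambda>x. ennreal (normal_density 0 (\<sigma> * sqrt (t - s)) x))"
  using bm by (simp add: brownian_motion_def)

lemma increments_indep:
  "0 \<le> ts 0 \<Longrightarrow> strict_mono ts \<Longrightarrow>
    indep_vars (\<lambda>_. borel) (\<lambda>i \<omega>. X (ts (Suc i)) \<omega> - X (ts i) \<omega>) {..<n}"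
  using bm unfolding brownian_motion_def by blast

text \<open>The shape is that of the Gaussian moment formula. The cases k = 1 and k = 2 give the
  variance and the fourth moment, three times its square.\<close>

lemma increment_even_moments:
  assumes "0 \<le> s" "s < t"
  shows "integrable M (\<lambda>\<omega>. (X t \<omega> - X s \<omega>) ^ (2 * k))"
    "expectation (\<lambda>\<omega>. (X t \<omega> - X s \<omega>) ^ (2 * k)) = fact (2 * k) / ((2 / (\<sigma>\<^sup>2 * (t - s))) ^ k * fact k)"
proof -
  let ?s = "\<sigma> * sqrt (t - s)"
  have s: "?s > 0" using assms vol_pos by simp
  have m: "has_bochner_integral lborel (\<lambda>x. normal_density 0 ?s x * x ^ (2 * k))
      (fact (2 * k) / ((2 / (\<sigma>\<^sup>2 * (t - s))) ^ k * fact k))"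
    using normal_moment_even[OF s, of 0 k] assms by (simp add: power_mult_distrib)
  show "integrable M (\<lambda>\<omega>. (X t \<omega> - X s \<omega>) ^ (2 * k))"
    using distributed_integrable[OF increment_distributed[OF assms], of "\<lambda>x. x ^ (2 * k)"] m s
    by (auto simp: has_bochner_integral_iff)
  show "expectation (\<lambda>\<omega>. (X t \<omega> - X s \<omega>) ^ (2 * k)) = fact (2 * k) / ((2 / (\<sigma>\<^sup>2 * (t - s))) ^ k * fact k)"
    using distributed_integral[OF increment_distributed[OF assms], of "\<lambda>x. x ^ (2 * k)"] m s
    by (auto simp: has_bochner_integral_iff)
qed

lemma increment_second_moment:
  assumes "0 \<le> s" "s < t"
  shows "integrable M (\<lambda>\<omega>. (X t \<omega> - X s \<omega>)\<^sup>2)" "expectation (\<lambda>\<omega>. (X t \<omega> - X s \<omega>)\<^sup>2) = \<sigma>\<^sup>2 * (t - s)"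
  using increment_even_moments[OF assms, of 1] by auto

lemma increment_centered_square:
  assumes "0 \<le> s" "s < t"
  shows "integrable M (\<lambda>\<omega>. ((X t \<omega> - X s \<omega>)\<^sup>2 - \<sigma>\<^sup>2 * (t - s))\<^sup>2)"
    "expectation (\<lambda>\<omega>. ((X t \<omega> - X s \<omega>)\<^sup>2 - \<sigma>\<^sup>2 * (t - s))\<^sup>2) = 2 * (\<sigma>\<^sup>2 * (t - s))\<^sup>2"
proof -
  let ?q = "\<sigma>\<^sup>2 * (t - s)"
  have eq: "((X t \<omega> - X s \<omega>)\<^sup>2 - ?q)\<^sup>2 = (X t \<omega> - X s \<omega>) ^ 4 - 2 * ?q * (X t \<omega> - X s \<omega>)\<^sup>2 + ?q\<^sup>2" for \<omega>
  proof -
    have "(y\<^sup>2 - ?q)\<^sup>2 = y ^ 4 - 2 * ?q * y\<^sup>2 + ?q\<^sup>2" for y :: real by algebra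
    then show ?thesis .
  qed
  have 4: "integrable M (\<lambda>\<omega>. (X t \<omega> - X s \<omega>) ^ 4)" "expectation (\<lambda>\<omega>. (X t \<omega> - X s \<omega>) ^ 4) = 3 * ?q\<^sup>2"
    using increment_even_moments[OF assms, of 2] by (auto simp: fact_numeral power_divide)
  note 2 = increment_second_moment[OF assms]
  show "integrable M (\<lambda>\<omega>. ((X t \<omega> - X s \<omega>)\<^sup>2 - ?q)\<^sup>2)"
    unfolding eq using 4 2 by auto
  show "expectation (\<lambda>\<omega>. ((X t \<omega> - X s \<omega>)\<^sup>2 - ?q)\<^sup>2) = 2 * ?q\<^sup>2"
    unfolding eq using 4 2 prob_space by (simp add: power2_eq_square)
qed

text \<open>Centered squares of independent increments are orthogonal, so second moments add. The
  grid runs over all naturals because independence is given along infinite strictly increasing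
  sequences of times.\<close>

lemma centered_squares_sum:
  fixes h :: real
  assumes h: "h > 0" and I: "finite I"
  defines "Y \<equiv> \<lambda>i \<omega>. (X (h * real (Suc i)) \<omega> - X (h * real i) \<omega>)\<^sup>2 - \<sigma>\<^sup>2 * h"
  shows "integrable M (\<lambda>\<omega>. (\<Sum>i\<in>I. Y i \<omega>)\<^sup>2)"
    "expectation (\<lambda>\<omega>. (\<Sum>i\<in>I. Y i \<omega>)\<^sup>2) = real (card I) * (2 * (\<sigma>\<^sup>2 * h)\<^sup>2)"
proof -
  obtain N where N: "I \<subseteq> {..<N}" using I by (meson finite_nat_iff_bounded)
  have st: "0 \<le> h * real i" "h * real i < h * real (Suc i)" "h * real (Suc i) - h * real i = h" for i
    using h by (auto simp: algebra_simps)
  have Y2: "integrable M (\<lambda>\<omega>. (Y i \<omega>)\<^sup>2)" "expectation (\<lambda>\<omega>. (Y i \<omega>)\<^sup>2) = 2 * (\<sigma>\<^sup>2 * h)\<^sup>2" for i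
    using increment_centered_square[OF st(1,2), of i] unfolding st(3) Y_def by auto
  have [measurable]: "Y i \<in> borel_measurable M" for i
  proof -
    have [measurable]: "X (h * real i) \<in> borel_measurable M" for i using st(1) by (rule X_measurable)
    show ?thesis unfolding Y_def by measurable
  qed
  have Y1: "integrable M (Y i)" for i by (rule square_integrable_imp_integrable[OF _ Y2(1)]) simp
  have Y0: "expectation (Y i) = 0" for i
    using increment_second_moment[OF st(1,2), of i] prob_space unfolding st(3) Y_def by simp
  have "strict_mono (\<lambda>i. h * real i)" using h by (auto simp: strict_mono_def)
  then have "indep_vars (\<lambda>_. borel) (\<lambda>i \<omega>. X (h * real (Suc i)) \<omega> - X (h * real i) \<omega>) {..<N}"
    using increments_indep[of "\<lambda>i. h * real i"] by simp
  then have ind: "indep_vars (\<lambda>_. borel) Y {..<N}"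
    unfolding Y_def by (rule indep_vars_compose2) measurable
  have orth: "expectation (\<lambda>\<omega>. Y i \<omega> * Y j \<omega>) = 0" if "i \<in> I" "j \<in> I" "i \<noteq> j" for i j
  proof -
    have "indep_vars (\<lambda>_. borel) Y {i, j}" by (rule indep_vars_subset[OF ind]) (use that N in auto)
    from indep_vars_lebesgue_integral[OF _ this] Y1 that show ?thesis by (simp add: Y0)
  qed
  have YY: "integrable M (\<lambda>\<omega>. Y i \<omega> * Y j \<omega>)" for i j
    by (rule integrable_mult_of_squares) (auto simp: Y2)
  have eq: "(\<Sum>i\<in>I. Y i \<omega>)\<^sup>2 = (\<Sum>i\<in>I. \<Sum>j\<in>I. Y i \<omega> * Y j \<omega>)" for \<omega>
    by (simp add: power2_eq_square sum_product)
  show "integrable M (\<lambda>\<omega>. (\<Sum>i\<in>I. Y i \<omega>)\<^sup>2)" unfolding eq using YY by auto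
  have "expectation (\<lambda>\<omega>. (\<Sum>i\<in>I. Y i \<omega>)\<^sup>2) = (\<Sum>i\<in>I. \<Sum>j\<in>I. expectation (\<lambda>\<omega>. Y i \<omega> * Y j \<omega>))"
    unfolding eq using YY by simp
  also have "\<dots> = (\<Sum>i\<in>I. \<Sum>j\<in>I. if j = i then 2 * (\<sigma>\<^sup>2 * h)\<^sup>2 else 0)"
    using orth Y2(2) by (intro sum.cong refl) (auto simp: power2_eq_square)
  also have "\<dots> = real (card I) * (2 * (\<sigma>\<^sup>2 * h)\<^sup>2)" using I by simp
  finally show "expectation (\<lambda>\<omega>. (\<Sum>i\<in>I. Y i \<omega>)\<^sup>2) = real (card I) * (2 * (\<sigma>\<^sup>2 * h)\<^sup>2)" .
qed

text \<open>The mesh halves at every level, so the second moments of the centered sums are of order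
  2^(-n). They are summable, which gives almost sure convergence along the whole sequence of
  levels.\<close>

lemma AE_dyadic_qv:
  assumes T: "T > 0"
  shows "AE \<omega> in M. dyadic_qv T (\<lambda>t. X t \<omega>) (\<sigma>\<^sup>2)"
proof -
  let ?D = "\<lambda>n i \<omega>. (X (dyad T n (Suc i)) \<omega> - X (dyad T n i) \<omega>)\<^sup>2"
  have dy: "dyad T n i = T / 2 ^ n * real i" for n i by (simp add: dyad_def)
  have [measurable]: "X (dyad T n i) \<in> borel_measurable M" for n i
    using T by (intro X_measurable) (simp add: dyad_def)
  have "AE \<omega> in M. (\<lambda>n. \<Sum>i\<in>block m n k. ?D n i \<omega>) \<longlonglongrightarrow> \<sigma>\<^sup>2 * T / 2 ^ m" for m k
  proof -
    have b: "finite (block m n k)" "card (block m n k) = 2 ^ (n - m)" for n by (auto simp: block_def)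
    have "AE \<omega> in M. (\<lambda>n. \<Sum>i\<in>block m n k. ?D n i \<omega> - \<sigma>\<^sup>2 * (T / 2 ^ n)) \<longlonglongrightarrow> 0"
    proof (rule AE_tendsto_0_of_summable_second_moments)
      show "(\<lambda>\<omega>. \<Sum>i\<in>block m n k. ?D n i \<omega> - \<sigma>\<^sup>2 * (T / 2 ^ n)) \<in> borel_measurable M" for n by measurable
      have h: "T / 2 ^ n > 0" for n using T by simp
      note c = centered_squares_sum[OF h b(1), folded dy]
      show "integrable M (\<lambda>\<omega>. (\<Sum>i\<in>block m n k. ?D n i \<omega> - \<sigma>\<^sup>2 * (T / 2 ^ n))\<^sup>2)" for n by (rule c(1))
      show "expectation (\<lambda>\<omega>. (\<Sum>i\<in>block m n k. ?D n i \<omega> - \<sigma>\<^sup>2 * (T / 2 ^ n))\<^sup>2) \<le> 2 * (\<sigma>\<^sup>2 * T)\<^sup>2 * (1 / 2) ^ n" for n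
      proof -
        \<comment> \<open>Valid also for n < m, where truncated subtraction makes the block the
          singleton {k}. Its sum has the right centering only from n = m on, hence the eventual
          equality further down.\<close>
        have "real (card (block m n k)) * (2 * (\<sigma>\<^sup>2 * (T / 2 ^ n))\<^sup>2) \<le> 2 ^ n * (2 * (\<sigma>\<^sup>2 * (T / 2 ^ n))\<^sup>2)"
          unfolding b(2) by (intro mult_right_mono) auto
        also have "\<dots> = 2 * (\<sigma>\<^sup>2 * T)\<^sup>2 * (1 / 2) ^ n"
          by (simp add: power2_eq_square field_simps)
        finally show ?thesis unfolding c(2) .
      qed
      show "summable (\<lambda>n. 2 * (\<sigma>\<^sup>2 * T)\<^sup>2 * (1 / 2) ^ n)" by (intro summable_mult summable_geometric) auto
    qed
    then show ?thesis
    proof eventually_elim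
      case (elim \<omega>)
      have "\<forall>\<^sub>F n in sequentially. (\<Sum>i\<in>block m n k. ?D n i \<omega> - \<sigma>\<^sup>2 * (T / 2 ^ n)) + \<sigma>\<^sup>2 * T / 2 ^ m
          = (\<Sum>i\<in>block m n k. ?D n i \<omega>)"
        using eventually_ge_at_top[of m]
      proof eventually_elim
        case (elim n)
        then have "(2::real) ^ n = 2 ^ m * 2 ^ (n - m)" by (simp flip: power_add)
        then show ?case by (simp add: sum_subtractf b(2))
      qed
      from tendsto_cong[THEN iffD1, OF this tendsto_add[OF elim tendsto_const]] show ?case by simp
    qed
  qed
  then have "AE \<omega> in M. \<forall>m k. (\<lambda>n. \<Sum>i\<in>block m n k. ?D n i \<omega>) \<longlonglongrightarrow> \<sigma>\<^sup>2 * T / 2 ^ m"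
    unfolding AE_all_countable by blast
  then show ?thesis by eventually_elim (auto simp: dyadic_qv_def)
qed

section \<open>Martingale transforms\<close>

lemma F_subalgebra: "0 \<le> t \<Longrightarrow> subalgebra M (F t)"
  using filt by (simp add: filtered_prob_space_def)

lemma F_mono_measurable:
  assumes "0 \<le> s" "s \<le> t" "Y \<in> measurable (F s) N" shows "Y \<in> measurable (F t) N"
proof (rule measurable_from_subalg[OF _ assms(3)])
  have "sets (F s) \<subseteq> sets (F t)" using filt assms(1,2) unfolding filtered_prob_space_def by blast
  then show "subalgebra (F t) (F s)"
    using F_subalgebra[OF assms(1)] F_subalgebra[of t] assms by (simp add: subalgebra_def)
qed

lemma F_measurable: "0 \<le> t \<Longrightarrow> Y \<in> measurable (F t) N \<Longrightarrow> Y \<in> measurable M N"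
  by (rule measurable_from_subalg[OF F_subalgebra])

lemma X_adapted: "0 \<le> t \<Longrightarrow> X t \<in> borel_measurable (F t)"
  using mart by (simp add: martingale_def adapted_def)

lemma X_square_integrable:
  assumes "0 \<le> t" shows "integrable M (\<lambda>\<omega>. (X t \<omega>)\<^sup>2)"
proof -
  have X0: "X 0 \<omega> = 0" if "\<omega> \<in> space M" for \<omega> using bm that by (simp add: brownian_motion_def)
  show ?thesis
  proof (cases "t = 0")
    case True
    then have "integrable M (\<lambda>\<omega>. (X t \<omega>)\<^sup>2) \<longleftrightarrow> integrable M (\<lambda>\<omega>. 0::real)"
      by (intro Bochner_Integration.integrable_cong) (auto simp: X0)
    then show ?thesis by simp
  next
    case False
    then have "integrable M (\<lambda>\<omega>. (X t \<omega> - X 0 \<omega>)\<^sup>2)" using increment_second_moment(1)[of 0 t] assms by simp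
    also have "integrable M (\<lambda>\<omega>. (X t \<omega> - X 0 \<omega>)\<^sup>2) \<longleftrightarrow> ?thesis"
      by (intro Bochner_Integration.integrable_cong) (auto simp: X0)
    finally show ?thesis .
  qed
qed

text \<open>The set-integral form of the martingale property identifies \<open>X s\<close> as the
  conditional expectation of \<open>X t\<close> given \<open>F s\<close>; the factor
  \<open>Y\<close>, measurable at time s, can then be pulled out.\<close>

lemma increment_orthogonal:
  assumes st: "0 \<le> s" "s \<le> t" and Y: "Y \<in> borel_measurable (F s)" "integrable M (\<lambda>\<omega>. (Y \<omega>)\<^sup>2)"
  shows "integrable M (\<lambda>\<omega>. Y \<omega> * (X t \<omega> - X s \<omega>))" "expectation (\<lambda>\<omega>. Y \<omega> * (X t \<omega> - X s \<omega>)) = 0"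
proof -
  interpret fm: finite_measure_subalgebra M "F s"
    using F_subalgebra[OF st(1)] by unfold_locales
  have t0: "0 \<le> t" using st by simp
  have [measurable]: "Y \<in> borel_measurable M" "X t \<in> borel_measurable M" "X s \<in> borel_measurable M"
    using F_measurable[OF st(1) Y(1)] st t0 by (auto intro: X_measurable)
  have YX: "integrable M (\<lambda>\<omega>. Y \<omega> * X t \<omega>)" "integrable M (\<lambda>\<omega>. Y \<omega> * X s \<omega>)"
    using Y(2) X_square_integrable st t0 by (auto intro!: integrable_mult_of_squares)
  then show "integrable M (\<lambda>\<omega>. Y \<omega> * (X t \<omega> - X s \<omega>))" by (simp add: right_diff_distrib)
  have "AE \<omega> in M. real_cond_exp M (F s) (X t) \<omega> = X s \<omega>"
    using mart st t0 unfolding martingale_def adapted_def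
    by (intro fm.real_cond_exp_charact) blast+
  then have "expectation (\<lambda>\<omega>. Y \<omega> * real_cond_exp M (F s) (X t) \<omega>) = expectation (\<lambda>\<omega>. Y \<omega> * X s \<omega>)"
    by (intro integral_cong_AE) auto
  then have "expectation (\<lambda>\<omega>. Y \<omega> * X t \<omega>) = expectation (\<lambda>\<omega>. Y \<omega> * X s \<omega>)"
    using fm.real_cond_exp_intg(2)[OF YX(1) Y(1)] by simp
  then show "expectation (\<lambda>\<omega>. Y \<omega> * (X t \<omega> - X s \<omega>)) = 0"
    using YX by (simp add: right_diff_distrib)
qed

text \<open>A one-sided discrete Ito isometry. Measurability with respect to \<open>F (t k)\<close>
  is carried through the induction so that S k times H k qualifies as the factor in
  \<open>increment_orthogonal\<close>, which kills the cross term. Squared increments are not taken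
  to be independent of \<open>F (t k)\<close>, so \<open>H\<close> is bounded by \<open>p\<close>
  before expectations are taken.\<close>

lemma martingale_transform:
  assumes t: "\<And>i. 0 \<le> t i" "\<And>i. t (Suc i) = t i + h" "h > 0"
    and H: "\<And>i. H i \<in> borel_measurable (F (t i))" "\<And>i \<omega>. \<omega> \<in> space M \<Longrightarrow> \<bar>H i \<omega>\<bar> \<le> p"
  defines "S \<equiv> \<lambda>k \<omega>. \<Sum>i<k. H i \<omega> * (X (t (Suc i)) \<omega> - X (t i) \<omega>)"
  shows "S k \<in> borel_measurable (F (t k)) \<and> integrable M (\<lambda>\<omega>. (S k \<omega>)\<^sup>2) \<and> expectation (S k) = 0
    \<and> expectation (\<lambda>\<omega>. (S k \<omega>)\<^sup>2) \<le> real k * (p\<^sup>2 * (\<sigma>\<^sup>2 * h))"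
proof (induction k)
  case 0
  show ?case by (simp add: S_def)
next
  case (Suc k)
  let ?d = "\<lambda>\<omega>. X (t (Suc k)) \<omega> - X (t k) \<omega>"
  have lt: "t k < t (Suc k)" "t (Suc k) - t k = h" using t by auto
  have S_Suc: "S (Suc k) = (\<lambda>\<omega>. S k \<omega> + H k \<omega> * ?d \<omega>)" by (simp add: S_def fun_eq_iff)
  have [measurable]: "S k \<in> borel_measurable (F (t (Suc k)))" "H k \<in> borel_measurable (F (t (Suc k)))"
    "X (t k) \<in> borel_measurable (F (t (Suc k)))" "X (t (Suc k)) \<in> borel_measurable (F (t (Suc k)))"
    using Suc H(1) X_adapted t lt by (auto intro: F_mono_measurable[of "t k"])
  have meas: "S (Suc k) \<in> borel_measurable (F (t (Suc k)))" unfolding S_Suc by measurable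
  have [measurable]: "S k \<in> borel_measurable M" "H k \<in> borel_measurable M" "?d \<in> borel_measurable M"
    by (rule F_measurable[OF t(1)[of "Suc k"]], measurable)+
  note d2 = increment_second_moment[OF t(1) lt(1), unfolded lt(2)]
  have S2: "integrable M (\<lambda>\<omega>. (S k \<omega>)\<^sup>2)" using Suc by simp
  have H2: "(H k \<omega>)\<^sup>2 \<le> p\<^sup>2" if "\<omega> \<in> space M" for \<omega>
    using H(2)[OF that, of k] by (metis abs_le_square_iff abs_ge_zero abs_of_nonneg order_trans)
  have Hd2: "integrable M (\<lambda>\<omega>. (H k \<omega> * ?d \<omega>)\<^sup>2)"
  proof (rule Bochner_Integration.integrable_bound[where f = "\<lambda>\<omega>. p\<^sup>2 * (?d \<omega>)\<^sup>2"])
    show "AE \<omega> in M. norm ((H k \<omega> * ?d \<omega>)\<^sup>2) \<le> norm (p\<^sup>2 * (?d \<omega>)\<^sup>2)"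
      using H2 by (auto simp: power_mult_distrib intro!: mult_right_mono)
  qed (use d2 in auto)
  have HH: "integrable M (\<lambda>\<omega>. (H k \<omega>)\<^sup>2)"
    by (rule integrable_const_bound[where B = "p\<^sup>2"]) (use H2 in auto)
  have SH2: "integrable M (\<lambda>\<omega>. (S k \<omega> * H k \<omega>)\<^sup>2)"
  proof (rule Bochner_Integration.integrable_bound[where f = "\<lambda>\<omega>. p\<^sup>2 * (S k \<omega>)\<^sup>2"])
    show "AE \<omega> in M. norm ((S k \<omega> * H k \<omega>)\<^sup>2) \<le> norm (p\<^sup>2 * (S k \<omega>)\<^sup>2)"
      using H2 by (auto simp: power_mult_distrib mult.commute[of "(S k _)\<^sup>2"] intro!: mult_right_mono)
  qed (use S2 in auto)
  have lin: "integrable M (\<lambda>\<omega>. H k \<omega> * ?d \<omega>)" "expectation (\<lambda>\<omega>. H k \<omega> * ?d \<omega>) = 0"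
    using increment_orthogonal[OF t(1) less_imp_le[OF lt(1)] H(1) HH] by auto
  have SH_meas: "(\<lambda>\<omega>. S k \<omega> * H k \<omega>) \<in> borel_measurable (F (t k))"
    using Suc H(1)[of k] by (intro borel_measurable_times) auto
  have cross: "integrable M (\<lambda>\<omega>. S k \<omega> * H k \<omega> * ?d \<omega>)" "expectation (\<lambda>\<omega>. S k \<omega> * H k \<omega> * ?d \<omega>) = 0"
    using increment_orthogonal[OF t(1) less_imp_le[OF lt(1)] SH_meas SH2] by auto
  have eq: "(S (Suc k) \<omega>)\<^sup>2 = (S k \<omega>)\<^sup>2 + 2 * (S k \<omega> * H k \<omega> * ?d \<omega>) + (H k \<omega> * ?d \<omega>)\<^sup>2" for \<omega>
    unfolding S_Suc power2_sum by (simp only: mult.assoc add.assoc add.commute)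
  have int: "integrable M (\<lambda>\<omega>. (S (Suc k) \<omega>)\<^sup>2)" unfolding eq using S2 cross Hd2 by auto
  have Sint: "integrable M (S k)" by (rule square_integrable_imp_integrable[OF _ S2]) simp
  have mean: "expectation (S (Suc k)) = 0" unfolding S_Suc using Sint lin Suc by simp
  have "expectation (\<lambda>\<omega>. (H k \<omega> * ?d \<omega>)\<^sup>2) \<le> expectation (\<lambda>\<omega>. p\<^sup>2 * (?d \<omega>)\<^sup>2)"
    using Hd2 d2 H2 by (intro integral_mono) (auto simp: power_mult_distrib intro!: mult_right_mono)
  also have "\<dots> = p\<^sup>2 * (\<sigma>\<^sup>2 * h)" using d2 by simp
  finally have Hd_le: "expectation (\<lambda>\<omega>. (H k \<omega> * ?d \<omega>)\<^sup>2) \<le> p\<^sup>2 * (\<sigma>\<^sup>2 * h)" .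
  have "expectation (\<lambda>\<omega>. (S (Suc k) \<omega>)\<^sup>2) = expectation (\<lambda>\<omega>. (S k \<omega>)\<^sup>2) + expectation (\<lambda>\<omega>. (H k \<omega> * ?d \<omega>)\<^sup>2)"
    unfolding eq using S2 cross Hd2 by simp
  also have "\<dots> \<le> real k * (p\<^sup>2 * (\<sigma>\<^sup>2 * h)) + p\<^sup>2 * (\<sigma>\<^sup>2 * h)"
    using Suc Hd_le by simp
  also have "\<dots> = real (Suc k) * (p\<^sup>2 * (\<sigma>\<^sup>2 * h))" by (simp add: distrib_right)
  finally have "expectation (\<lambda>\<omega>. (S (Suc k) \<omega>)\<^sup>2) \<le> real (Suc k) * (p\<^sup>2 * (\<sigma>\<^sup>2 * h))" .
  then show ?case using meas int mean by blast
qed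

end

section \<open>Solutions of the Skorohod problem\<close>

text \<open>The measure of {s<..t} is l t - l s, and the hypothesis bounds it by 0. The comparison
  uses monotonicity of the nonnegative integral, which holds for arbitrary functions, so the set
  where \<open>P\<close> holds may fail to be Borel.\<close>

lemma stieltjes_flat:
  assumes l: "mono_on {0..} l" "continuous_on {0..} l"
    and zero: "(\<integral>\<^sup>+ r. indicator {r\<in>{0..t}. P r} r \<partial>stieltjes l) = 0"
    and st: "0 \<le> s" "s < t" and P: "\<And>r. r \<in> {s<..t} \<Longrightarrow> P r"
  shows "l t = l s"
proof -
  let ?l = "\<lambda>r. l (max 0 r)"
  have "continuous_on UNIV ?l"
    by (rule continuous_on_compose2[OF l(2)]) (auto intro!: continuous_intros)
  then have cont: "continuous (at_right a) ?l" for a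
    by (simp add: continuous_on_eq_continuous_within continuous_at_imp_continuous_at_within)
  have "emeasure (stieltjes l) {s<..t} = ennreal (?l t - ?l s)"
    unfolding stieltjes_def using st cont
    by (intro emeasure_interval_measure_Ioc) (auto intro!: mono_onD[OF l(1)])
  moreover have "emeasure (stieltjes l) {s<..t} = (\<integral>\<^sup>+ r. indicator {s<..t} r \<partial>stieltjes l)"
    by (simp add: stieltjes_def)
  moreover have "\<dots> \<le> (\<integral>\<^sup>+ r. indicator {r\<in>{0..t}. P r} r \<partial>stieltjes l)"
    using P st by (intro nn_integral_mono) (auto simp: indicator_def)
  ultimately have "ennreal (?l t - ?l s) = 0" using zero by simp
  then have "l t \<le> l s" using st by (simp add: ennreal_eq_0_iff)
  moreover have "l s \<le> l t" using st by (auto intro: mono_onD[OF l(1)])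
  ultimately show ?thesis by simp
qed

lemma integrable_along_path:
  fixes g z :: "real \<Rightarrow> real"
  assumes g: "g \<in> borel_measurable (restrict_space borel {0..b})" "\<And>y. y \<in> {0..b} \<Longrightarrow> \<bar>g y\<bar> \<le> K"
    and z: "z \<in> borel_measurable (restrict_space borel {0..T})" "\<And>t. t \<in> {0..T} \<Longrightarrow> z t \<in> {0..b}"
  shows "(\<lambda>s. g (z s)) integrable_on {0..T}"
proof -
  have "z \<in> measurable (restrict_space borel {0..T}) (restrict_space borel {0..b})"
    using z by (intro measurable_restrict_space2) (auto simp: space_restrict_space)
  from measurable_compose[OF this g(1)]
  have m: "(\<lambda>s. indicator {0..T} s *\<^sub>R g (z s)) \<in> borel_measurable borel"
    by (simp add: borel_measurable_restrict_space_iff)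
  have "set_integrable lborel {0..T} (\<lambda>s. g (z s))"
    unfolding set_integrable_def
    by (rule integrableI_bounded_set[where A = "{0..T}" and B = K]) (use m g(2) z(2) in \<open>auto simp: emeasure_lborel_Icc_eq\<close>)
  then show ?thesis by (rule set_borel_integral_eq_integral)
qed

text \<open>The integrand need not be integrable: on intervals where it is not, \<open>integral\<close> is the junk value 0.
  This is what lets one show that paths of a Skorohod solution, which are not assumed to be
  measurable, make the drift integrable.\<close>
lemma indefinite_integral_borel_measurable:
  fixes h :: "real \<Rightarrow> real"
  assumes T: "0 \<le> T"
  shows "(\<lambda>t. integral {0..t} h) \<in> borel_measurable (restrict_space borel {0..T})"
proof -
  let ?F = "\<lambda>t. integral {0..t} h"
  \<comment> \<open>Integrability passes to subintervals, so \<open>I\<close> is an initial segment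
    of [0,T] with right end \<open>s\<close>. The indefinite integral is continuous on [0,s) and 0
    beyond \<open>s\<close>.\<close>
  define I where "I = {t \<in> {0..T}. h integrable_on {0..t}}"
  define s where "s = Sup I"
  have I: "0 \<in> I" "bdd_above I" using T integrable_on_refl[of h 0] by (auto simp: I_def intro: bdd_aboveI[of _ T])
  have I_le: "x \<in> I \<Longrightarrow> x \<le> T" for x by (simp add: I_def)
  have s: "0 \<le> s" "s \<le> T" unfolding s_def
    using I cSup_upper[of 0 I] cSup_least[of I T] I_le by blast+
  have "continuous_on {0..<s} ?F"
    unfolding continuous_on_eq_continuous_within
  proof
    fix t assume t: "t \<in> {0..<s}"
    then obtain t' where t': "t' \<in> I" "t < t'" using less_cSupE[of t I] I unfolding s_def by auto
    have "t' \<le> s" unfolding s_def using t' I by (intro cSup_upper)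
    then have "at t within {0..<s} = at t within {0..t'}"
      using t' by (intro at_within_nhd[of t "{..<t'}"]) auto
    moreover have "continuous_on {0..t'} ?F"
      using t' by (intro indefinite_integral_continuous_1) (auto simp: I_def)
    ultimately show "continuous (at t within {0..<s}) ?F"
      using t t' by (auto simp: continuous_on_eq_continuous_within)
  qed
  then have 1: "(\<lambda>t. indicator {0..<s} t *\<^sub>R ?F t) \<in> borel_measurable borel"
    by (subst borel_measurable_restrict_space_iff[symmetric])
      (auto intro: borel_measurable_continuous_on_restrict)
  have "?F t = 0" if "s < t" "t \<le> T" for t
  proof (rule not_integrable_integral)
    show "\<not> h integrable_on {0..t}"
    proof
      assume "h integrable_on {0..t}"
      then have "t \<in> I" using that s by (simp add: I_def)
      then show False using cSup_upper[of t I] I(2) that by (simp add: s_def)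
    qed
  qed
  \<comment> \<open>Whether \<open>h\<close> is integrable up to \<open>s\<close> itself is
    undecided, so that single point is split off.\<close>
  then have "(\<lambda>t. indicator {0..T} t *\<^sub>R ?F t) = (\<lambda>t. indicator {0..<s} t *\<^sub>R ?F t + indicator {s} t * ?F s)"
    using s by (auto simp: fun_eq_iff indicator_def)
  then have "(\<lambda>t. indicator {0..T} t *\<^sub>R ?F t) \<in> borel_measurable borel"
    using 1 by simp
  then show ?thesis by (subst borel_measurable_restrict_space_iff) auto
qed

context drift_control begin

lemma admissible_integrable:
  fixes z :: "real \<Rightarrow> real"
  assumes adm: "admissible A b \<theta>"
    and z: "continuous_on {0..T} z" "\<And>t. t \<in> {0..T} \<Longrightarrow> z t \<in> {0..b}"
  shows "(\<lambda>s. \<theta> (z s)) integrable_on {0..T}" "(\<lambda>s. v (z s) * \<theta> (z s)) integrable_on {0..T}"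
    "(\<lambda>s. c (\<theta> (z s))) integrable_on {0..T}" "(\<lambda>s. d (z s)) integrable_on {0..T}"
    "\<exists>H. \<forall>s\<in>{0..T}. \<bar>\<theta> (z s)\<bar> \<le> H"
proof -
  have zm: "z \<in> borel_measurable (restrict_space borel {0..T})"
    by (rule borel_measurable_continuous_on_restrict[OF z(1)])
  note [measurable] = adm[unfolded admissible_def, THEN conjunct2, THEN conjunct2]
  have in_A: "\<theta> y \<in> A" if "y \<in> {0..b}" for y using adm that by (simp add: admissible_def)
  obtain H where H: "\<And>y. y \<in> {0..b} \<Longrightarrow> \<bar>\<theta> y\<bar> \<le> H"
    using adm unfolding admissible_def bounded_real by blast
  show "(\<lambda>s. \<theta> (z s)) integrable_on {0..T}"
    by (rule integrable_along_path[where g = \<theta> and K = H and b = b]) (use H z(2) zm in auto)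
  show "\<exists>H. \<forall>s\<in>{0..T}. \<bar>\<theta> (z s)\<bar> \<le> H" using H z(2) by blast
  have vm [measurable]: "v \<in> borel_measurable (restrict_space borel {0..b})"
    by (rule borel_measurable_continuous_on_restrict[OF v_continuous])
  show "(\<lambda>s. v (z s) * \<theta> (z s)) integrable_on {0..T}"
  proof (rule integrable_along_path[where g = "\<lambda>y. v y * \<theta> y" and K = "p * H", OF _ _ zm z(2)])
    show "(\<lambda>y. v y * \<theta> y) \<in> borel_measurable (restrict_space borel {0..b})" by measurable
    show "\<bar>v y * \<theta> y\<bar> \<le> p * H" if "y \<in> {0..b}" for y
      using H[OF that] v_range[OF that] unfolding abs_mult by (intro mult_mono) auto
  qed
  have "continuous_on {0..T} (\<lambda>s. d (z s))"
    using z by (auto intro!: continuous_on_compose2[OF d_continuous])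
  then show "(\<lambda>s. d (z s)) integrable_on {0..T}" by (rule integrable_continuous_real)
  have \<theta>A: "\<theta> \<in> measurable (restrict_space borel {0..b}) (restrict_space borel A)"
    using in_A by (intro measurable_restrict_space2) (auto simp: space_restrict_space)
  \<comment> \<open>The bound \<open>H\<close> need not lie in \<open>A\<close>, so c H says
    nothing. The closed set \<open>B\<close> has a greatest element, and there \<open>c\<close>
    bounds the running cost.\<close>
  define B where "B = A \<inter> {..H}"
  have \<theta>B: "\<theta> y \<in> B" if "y \<in> {0..b}" for y using in_A[OF that] H[OF that] by (auto simp: B_def)
  have "\<theta> 0 \<in> B" using \<theta>B b_pos by simp
  then have "B \<noteq> {}" "bdd_above B" "closed B" using A_closed by (auto simp: B_def)
  then have "Sup B \<in> B" and SB: "\<And>y. y \<in> B \<Longrightarrow> y \<le> Sup B"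
    using closed_contains_Sup[of B] by (auto intro: cSup_upper)
  then have SA: "Sup B \<in> A" by (simp add: B_def)
  show "(\<lambda>s. c (\<theta> (z s))) integrable_on {0..T}"
  proof (rule integrable_along_path[where g = "\<lambda>y. c (\<theta> y)" and K = "c (Sup B)", OF _ _ zm z(2)])
    show "(\<lambda>y. c (\<theta> y)) \<in> borel_measurable (restrict_space borel {0..b})"
      by (rule measurable_compose[OF \<theta>A borel_measurable_mono_on_fnc[OF c_mono]])
    show "\<bar>c (\<theta> y)\<bar> \<le> c (Sup B)" if "y \<in> {0..b}" for y
      using c_nonneg[OF in_A[OF that]] mono_onD[OF c_mono in_A[OF that] SA] SB[OF \<theta>B[OF that]] by simp
  qed
qed

text \<open>This breaks a circle: continuity of \<open>z\<close> needs an integrable drift, whose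
  integrability needs a measurable \<open>z\<close>. The right-hand side of the equation is
  measurable whether or not the drift is integrable, so \<open>z\<close> is measurable, the drift
  integrable, and finally the right-hand side continuous.\<close>

lemma path_continuous:
  fixes x z l u :: "real \<Rightarrow> real"
  assumes adm: "admissible A b \<theta>" and T: "0 \<le> T"
    and cont: "continuous_on {0..T} x" "continuous_on {0..T} l" "continuous_on {0..T} u"
    and zr: "\<And>t. t \<in> {0..T} \<Longrightarrow> z t \<in> {0..b}"
    and eq: "\<And>t. t \<in> {0..T} \<Longrightarrow> z t = z0 + x t - integral {0..t} (\<lambda>s. \<theta> (z s)) + l t - u t"
  shows "continuous_on {0..T} z"
proof -
  let ?R = "\<lambda>t. z0 + x t - integral {0..t} (\<lambda>s. \<theta> (z s)) + l t - u t"
  obtain H where H: "\<And>y. y \<in> {0..b} \<Longrightarrow> \<bar>\<theta> y\<bar> \<le> H"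
    using adm unfolding admissible_def bounded_real by blast
  note [measurable] = cont[THEN borel_measurable_continuous_on_restrict]
    indefinite_integral_borel_measurable[OF T]
  have "?R \<in> borel_measurable (restrict_space borel {0..T})" by measurable
  also have "?R \<in> borel_measurable (restrict_space borel {0..T}) \<longleftrightarrow> z \<in> borel_measurable (restrict_space borel {0..T})"
    by (rule measurable_cong) (use eq in \<open>auto simp: space_restrict_space\<close>)
  finally have "(\<lambda>s. \<theta> (z s)) integrable_on {0..T}"
    using adm H zr by (intro integrable_along_path[where K = H and b = b]) (auto simp: admissible_def)
  then have "continuous_on {0..T} ?R"
    by (intro continuous_intros cont indefinite_integral_continuous_1)
  then show ?thesis by (rule continuous_on_eq) (use eq in simp)
qed

lemma skorohod_path_continuous:
  assumes adm: "admissible A b \<theta>" and sk: "skorohod_solution M F \<sigma> b \<theta> z0 X Z L U"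
    and \<omega>: "\<omega> \<in> space M" and T: "0 \<le> T"
  shows "continuous_on {0..T} (\<lambda>t. Z t \<omega>)"
proof (rule path_continuous[OF adm T])
  have "continuous_on {0..} (\<lambda>t. X t \<omega>)" "continuous_on {0..} (\<lambda>t. L t \<omega>)" "continuous_on {0..} (\<lambda>t. U t \<omega>)"
    using sk \<omega> unfolding skorohod_solution_def brownian_motion_def by blast+
  then show "continuous_on {0..T} (\<lambda>t. X t \<omega>)" "continuous_on {0..T} (\<lambda>t. L t \<omega>)" "continuous_on {0..T} (\<lambda>t. U t \<omega>)"
    by (auto elim: continuous_on_subset)
  have "\<forall>t\<ge>0. Z t \<omega> \<in> {0..b}" using sk \<omega> unfolding skorohod_solution_def by blast
  then show "Z t \<omega> \<in> {0..b}" if "t \<in> {0..T}" for t using that by simp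
  show "Z t \<omega> = z0 + X t \<omega> - integral {0..t} (\<lambda>s. \<theta> (Z s \<omega>)) + L t \<omega> - U t \<omega>" if "t \<in> {0..T}" for t
    using sk \<omega> that unfolding skorohod_solution_def atLeastAtMost_iff by blast
qed

section \<open>Expected costs and long-run averages\<close>

lemma skorohod_ito:
  fixes M :: "'w measure"
  assumes adm: "admissible A b \<theta>" and sk: "skorohod_solution M F \<sigma> b \<theta> z0 X Z L U" and T: "T > 0"
  shows "\<exists>Y. integrable M Y \<and> (\<integral>\<omega>. Y \<omega> \<partial>M) = 0 \<and> (AE \<omega> in M. Y \<omega> = f (Z T \<omega>) - f z0
      - \<sigma>\<^sup>2 / 2 * integral {0..T} (\<lambda>s. d (Z s \<omega>)) + integral {0..T} (\<lambda>s. v (Z s \<omega>) * \<theta> (Z s \<omega>)) + p * U T \<omega>)"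
proof -
  have sk': "filtered_prob_space M F" "brownian_motion M \<sigma> X" "martingale M F X" "adapted M F Z"
    and eq: "\<And>\<omega> t. \<omega> \<in> space M \<Longrightarrow> 0 \<le> t \<Longrightarrow> Z t \<omega> = z0 + X t \<omega> - integral {0..t} (\<lambda>s. \<theta> (Z s \<omega>)) + L t \<omega> - U t \<omega>"
    and Zr: "\<And>\<omega> t. \<omega> \<in> space M \<Longrightarrow> 0 \<le> t \<Longrightarrow> Z t \<omega> \<in> {0..b}"
    and Lp: "\<And>\<omega>. \<omega> \<in> space M \<Longrightarrow> mono_on {0..} (\<lambda>t. L t \<omega>) \<and> continuous_on {0..} (\<lambda>t. L t \<omega>) \<and> L 0 \<omega> = 0"
    and Up: "\<And>\<omega>. \<omega> \<in> space M \<Longrightarrow> mono_on {0..} (\<lambda>t. U t \<omega>) \<and> continuous_on {0..} (\<lambda>t. U t \<omega>) \<and> U 0 \<omega> = 0"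
    and Lz: "\<And>\<omega> t. \<omega> \<in> space M \<Longrightarrow> 0 \<le> t \<Longrightarrow> (\<integral>\<^sup>+ s. indicator {s\<in>{0..t}. Z s \<omega> > 0} s \<partial>stieltjes (\<lambda>r. L r \<omega>)) = 0"
    and Uz: "\<And>\<omega> t. \<omega> \<in> space M \<Longrightarrow> 0 \<le> t \<Longrightarrow> (\<integral>\<^sup>+ s. indicator {s\<in>{0..t}. Z s \<omega> < b} s \<partial>stieltjes (\<lambda>r. U r \<omega>)) = 0"
    using sk unfolding skorohod_solution_def by blast+
  interpret prob_space M using sk'(1) by (simp add: filtered_prob_space_def)
  interpret filtered_brownian M F X \<sigma> by unfold_locales (use sk' sigma_pos in auto)
  have X_path: "continuous_on {0..} (\<lambda>t. X t \<omega>)" "X 0 \<omega> = 0" if "\<omega> \<in> space M" for \<omega>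
    using sk'(2) that by (auto simp: brownian_motion_def)
  define S where "S n \<omega> = (\<Sum>i<2 ^ n. v (Z (dyad T n i) \<omega>) * (X (dyad T n (Suc i)) \<omega> - X (dyad T n i) \<omega>))" for n \<omega>
  have dy: "0 \<le> dyad T n i" "dyad T n (Suc i) = dyad T n i + T / 2 ^ n" for n i
    using T by (auto simp: dyad_def field_simps)
  have vm: "v \<in> borel_measurable (restrict_space borel {0..b})"
    by (rule borel_measurable_continuous_on_restrict[OF v_continuous])
  \<comment> \<open>Since \<open>v\<close> is controlled only on [0,b], \<open>Z t\<close> is
    regarded as a map into that restricted space.\<close>
  have Hm: "(\<lambda>\<omega>. v (Z t \<omega>)) \<in> borel_measurable (F t)" if "0 \<le> t" for t
  proof (rule measurable_compose[OF _ vm])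
    show "Z t \<in> measurable (F t) (restrict_space borel {0..b})"
      using sk'(4) Zr that F_subalgebra[OF that]
      by (intro measurable_restrict_space2) (auto simp: adapted_def subalgebra_def)
  qed
  have Hb: "\<bar>v (Z t \<omega>)\<bar> \<le> p" if "\<omega> \<in> space M" "0 \<le> t" for \<omega> t
    using v_range[OF Zr[OF that]] by simp
  have Sprops: "S n \<in> borel_measurable M" "integrable M (\<lambda>\<omega>. (S n \<omega>)\<^sup>2)" "expectation (S n) = 0"
    "expectation (\<lambda>\<omega>. (S n \<omega>)\<^sup>2) \<le> p\<^sup>2 * (\<sigma>\<^sup>2 * T)" for n
  proof -
    have "0 < T / 2 ^ n" using T by simp
    \<comment> \<open>There are 2^n steps, each contributing at most p^2 \<sigma>^2 T / 2^n: the
      second moment bound does not depend on n.\<close>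
    note m = martingale_transform[of "dyad T n", OF dy this Hm[OF dy(1)] Hb[OF _ dy(1)], of "2 ^ n"]
    show "S n \<in> borel_measurable M" "integrable M (\<lambda>\<omega>. (S n \<omega>)\<^sup>2)" "expectation (S n) = 0"
      "expectation (\<lambda>\<omega>. (S n \<omega>)\<^sup>2) \<le> p\<^sup>2 * (\<sigma>\<^sup>2 * T)"
      unfolding S_def using m F_measurable[of T] T by (auto simp: mult.assoc)
  qed
  \<comment> \<open>\<open>lim\<close> of measurable functions is measurable outright, whereas the
    path integrals in \<open>?R\<close> are not known to be measurable in \<omega>. Hence
    \<open>Y\<close> is defined by the limit and equals \<open>?R\<close> only almost
    surely.\<close>
  define Y where "Y \<omega> = lim (\<lambda>n. S n \<omega>)" for \<omega>
  let ?R = "\<lambda>\<omega>. f (Z T \<omega>) - f z0 - \<sigma>\<^sup>2 / 2 * integral {0..T} (\<lambda>s. d (Z s \<omega>))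
    + integral {0..T} (\<lambda>s. v (Z s \<omega>) * \<theta> (Z s \<omega>)) + p * U T \<omega>"
  have lim: "AE \<omega> in M. (\<lambda>n. S n \<omega>) \<longlonglongrightarrow> ?R \<omega>"
    using AE_dyadic_qv[OF T] AE_space
  proof eventually_elim
    case (elim \<omega>)
    note \<omega> = elim(2)
    have LU: "continuous_on {0..T} (\<lambda>t. L t \<omega>)" "continuous_on {0..T} (\<lambda>t. U t \<omega>)" "continuous_on {0..T} (\<lambda>t. X t \<omega>)"
      "mono_on {0..T} (\<lambda>t. L t \<omega>)" "mono_on {0..T} (\<lambda>t. U t \<omega>)"
      using Lp[OF \<omega>] Up[OF \<omega>] X_path[OF \<omega>]
      by (auto intro: continuous_on_subset mono_on_subset)
    have zr: "\<And>t. t \<in> {0..T} \<Longrightarrow> Z t \<omega> \<in> {0..b}" using Zr[OF \<omega>] by auto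
    note Zc = skorohod_path_continuous[OF adm sk \<omega> less_imp_le[OF T]]
    note ai = admissible_integrable[OF adm Zc zr]
    obtain H where H: "\<And>s. s \<in> {0..T} \<Longrightarrow> \<bar>\<theta> (Z s \<omega>)\<bar> \<le> H" using ai(5) by blast
    have Z0: "Z 0 \<omega> = z0" using eq[OF \<omega>, of 0] X_path[OF \<omega>] Lp[OF \<omega>] Up[OF \<omega>] by simp
    have "(\<lambda>n. S n \<omega>) \<longlonglongrightarrow> f (Z T \<omega>) - f (Z 0 \<omega>) - \<sigma>\<^sup>2 / 2 * integral {0..T} (\<lambda>s. d (Z s \<omega>))
        + integral {0..T} (\<lambda>s. v (Z s \<omega>) * \<theta> (Z s \<omega>)) + p * U T \<omega>"
      unfolding S_def
    proof (rule pathwise_ito[where l = "\<lambda>t. L t \<omega>" and H = H and ?z0.0 = z0, OF _ LU(3) Zc LU(4) _ LU(5) _ zr])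
      show "L t \<omega> = L s \<omega>" if "0 \<le> s" "s < t" "\<And>r. r \<in> {s<..t} \<Longrightarrow> 0 < Z r \<omega>" for s t
        using Lp[OF \<omega>] Lz[OF \<omega>, of t] that by (intro stieltjes_flat[where P = "\<lambda>r. 0 < Z r \<omega>"]) auto
      show "U t \<omega> = U s \<omega>" if "0 \<le> s" "s < t" "\<And>r. r \<in> {s<..t} \<Longrightarrow> Z r \<omega> < b" for s t
        using Up[OF \<omega>] Uz[OF \<omega>, of t] that by (intro stieltjes_flat[where P = "\<lambda>r. Z r \<omega> < b"]) auto
    qed (use T Lp[OF \<omega>] Up[OF \<omega>] eq[OF \<omega>] ai H elim(1) in auto)
    then show ?case unfolding Z0 .
  qed
  have [measurable]: "S n \<in> borel_measurable M" for n by (rule Sprops(1))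
  have Ym: "Y \<in> borel_measurable M" unfolding Y_def by measurable
  have Yeq: "AE \<omega> in M. Y \<omega> = ?R \<omega>" using lim by eventually_elim (simp add: Y_def limI)
  have "AE \<omega> in M. (\<lambda>n. S n \<omega>) \<longlonglongrightarrow> Y \<omega>" using lim Yeq by eventually_elim simp
  from L2_bounded_limit_centered[OF Sprops(1) Ym Sprops(2,3,4) this] Yeq
  show ?thesis by blast
qed

lemma expected_cost_bounds:
  fixes M :: "'w measure"
  assumes adm: "admissible A b \<theta>" and sk: "skorohod_solution M F \<sigma> b \<theta> z0 X Z L U"
    and z0: "z0 \<in> {0..b}" and T: "T > 0" and K: "\<And>z. z \<in> {0..b} \<Longrightarrow> \<bar>f z\<bar> \<le> K"
  shows "ennreal (gam * T - 2 * K) \<le> expected_cost M c p \<theta> Z U T"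
    and "\<theta> = cand_policy A c \<sigma> b p \<Longrightarrow> expected_cost M c p \<theta> Z U T \<le> ennreal (gam * T + 2 * K)"
proof -
  interpret prob_space M using sk by (simp add: skorohod_solution_def filtered_prob_space_def)
  have Zr: "\<And>\<omega> t. \<omega> \<in> space M \<Longrightarrow> 0 \<le> t \<Longrightarrow> Z t \<omega> \<in> {0..b}"
    and ZF: "Z T \<in> borel_measurable (F T)" "subalgebra M (F T)"
  proof -
    have "\<forall>\<omega>\<in>space M. \<forall>t\<ge>0. Z t \<omega> \<in> {0..b}" "adapted M F Z" "filtered_prob_space M F"
      using sk unfolding skorohod_solution_def by blast+
    then show "\<And>\<omega> t. \<omega> \<in> space M \<Longrightarrow> 0 \<le> t \<Longrightarrow> Z t \<omega> \<in> {0..b}"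
      "Z T \<in> borel_measurable (F T)" "subalgebra M (F T)"
      using T by (simp_all add: adapted_def filtered_prob_space_def)
  qed
  obtain Y where Y: "integrable M Y" "expectation Y = 0" "AE \<omega> in M. Y \<omega> = f (Z T \<omega>) - f z0
      - \<sigma>\<^sup>2 / 2 * integral {0..T} (\<lambda>s. d (Z s \<omega>)) + integral {0..T} (\<lambda>s. v (Z s \<omega>) * \<theta> (Z s \<omega>)) + p * U T \<omega>"
    using skorohod_ito[OF adm sk T] by blast
  have Zm: "Z T \<in> measurable M (restrict_space borel {0..b})"
    using measurable_from_subalg[OF ZF(2,1)] Zr T by (intro measurable_restrict_space2) auto
  have fZ: "integrable M (\<lambda>\<omega>. f (Z T \<omega>))"
  proof (rule integrable_const_bound[where B = K])
    show "AE \<omega> in M. norm (f (Z T \<omega>)) \<le> K" using K Zr T by auto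
    show "(\<lambda>\<omega>. f (Z T \<omega>)) \<in> borel_measurable M"
      by (rule measurable_compose[OF Zm borel_measurable_continuous_on_restrict[OF f_continuous]])
  qed
  \<comment> \<open>The Ito formula turns the cost into W - gam T + \<open>?J\<close>; the
    optimality inequality says \<open>?J\<close> is at least gam T, with equality for the
    candidate.\<close>
  define W where "W \<omega> = gam * T - f (Z T \<omega>) + f z0 + Y \<omega>" for \<omega>
  have W: "integrable M W" unfolding W_def using fZ Y(1) by auto
  have EW: "expectation W = gam * T - expectation (\<lambda>\<omega>. f (Z T \<omega>)) + f z0"
    unfolding W_def using fZ Y(1,2) prob_space by simp
  have "\<bar>expectation (\<lambda>\<omega>. f (Z T \<omega>))\<bar> \<le> expectation (\<lambda>\<omega>. \<bar>f (Z T \<omega>)\<bar>)" by (rule integral_abs_bound)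
  also have "\<dots> \<le> expectation (\<lambda>\<omega>. K)" using fZ K Zr T by (intro integral_mono) auto
  finally have Ef: "\<bar>expectation (\<lambda>\<omega>. f (Z T \<omega>))\<bar> \<le> K" using prob_space by simp
  have EW_bounds: "gam * T - 2 * K \<le> expectation W" "expectation W \<le> gam * T + 2 * K"
    using EW Ef K[OF z0] by linarith+
  have path: "(\<lambda>s. d (Z s \<omega>)) integrable_on {0..T}" "(\<lambda>s. c (\<theta> (Z s \<omega>))) integrable_on {0..T}"
    "(\<lambda>s. v (Z s \<omega>) * \<theta> (Z s \<omega>)) integrable_on {0..T}" if "\<omega> \<in> space M" for \<omega>
    using admissible_integrable[OF adm skorohod_path_continuous[OF adm sk that less_imp_le[OF T]]] Zr[OF that] by auto
  let ?J = "\<lambda>\<omega>. integral {0..T} (\<lambda>s. \<sigma>\<^sup>2 / 2 * d (Z s \<omega>) - v (Z s \<omega>) * \<theta> (Z s \<omega>) + c (\<theta> (Z s \<omega>)))"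
  have J: "(\<lambda>s. \<sigma>\<^sup>2 / 2 * d (Z s \<omega>) - v (Z s \<omega>) * \<theta> (Z s \<omega>) + c (\<theta> (Z s \<omega>))) integrable_on {0..T}"
    "?J \<omega> = \<sigma>\<^sup>2 / 2 * integral {0..T} (\<lambda>s. d (Z s \<omega>)) - integral {0..T} (\<lambda>s. v (Z s \<omega>) * \<theta> (Z s \<omega>))
      + integral {0..T} (\<lambda>s. c (\<theta> (Z s \<omega>)))" if "\<omega> \<in> space M" for \<omega>
  proof -
    note 1 = integrable_on_mult_right[OF path(1)[OF that], of "\<sigma>\<^sup>2 / 2"]
    note 2 = integrable_diff[OF 1 path(3)[OF that]]
    show "(\<lambda>s. \<sigma>\<^sup>2 / 2 * d (Z s \<omega>) - v (Z s \<omega>) * \<theta> (Z s \<omega>) + c (\<theta> (Z s \<omega>))) integrable_on {0..T}"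
      by (rule integrable_add[OF 2 path(2)[OF that]])
    show "?J \<omega> = \<sigma>\<^sup>2 / 2 * integral {0..T} (\<lambda>s. d (Z s \<omega>)) - integral {0..T} (\<lambda>s. v (Z s \<omega>) * \<theta> (Z s \<omega>))
      + integral {0..T} (\<lambda>s. c (\<theta> (Z s \<omega>)))"
      by (simp only: integral_add[OF 2 path(2)[OF that]] integral_diff[OF 1 path(3)[OF that]] integral_mult_right)
  qed
  have cost: "AE \<omega> in M. cost_process c p \<theta> Z U T \<omega> = W \<omega> - gam * T + ?J \<omega>"
    using Y(3) AE_space
  proof eventually_elim
    case (elim \<omega>)
    show ?case unfolding cost_process_def W_def elim(1) J(2)[OF elim(2)] by simp
  qed
  have in_A: "\<theta> y \<in> A" if "y \<in> {0..b}" for y using adm that by (simp add: admissible_def)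
  have "ennreal (gam * T - 2 * K) \<le> ennreal (expectation W)" using EW_bounds by (simp add: ennreal_leI)
  \<comment> \<open>\<open>W\<close> may be negative; its positive part is what translates into a
    nonnegative integral, and it still lies below the nonnegative cost.\<close>
  also have "\<dots> \<le> ennreal (expectation (\<lambda>\<omega>. max 0 (W \<omega>)))"
    using W by (intro ennreal_leI integral_mono) auto
  also have "\<dots> = (\<integral>\<^sup>+\<omega>. ennreal (max 0 (W \<omega>)) \<partial>M)"
    using W by (intro nn_integral_eq_integral[symmetric]) auto
  also have "\<dots> \<le> expected_cost M c p \<theta> Z U T"
    unfolding expected_cost_def
  proof (rule nn_integral_mono_AE)
    show "AE \<omega> in M. ennreal (max 0 (W \<omega>)) \<le> ennreal (cost_process c p \<theta> Z U T \<omega>)"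
      using cost AE_space
    proof eventually_elim
      case (elim \<omega>)
      have "integral {0..T} (\<lambda>_. gam) \<le> ?J \<omega>"
      proof (rule integral_le[OF integrable_const_ivl J(1)[OF elim(2)]])
        fix s assume "s \<in> {0..T}"
        then have "Z s \<omega> \<in> {0..b}" using Zr[OF elim(2)] by auto
        from hjb_ineq[OF this in_A[OF this]]
        show "gam \<le> \<sigma>\<^sup>2 / 2 * d (Z s \<omega>) - v (Z s \<omega>) * \<theta> (Z s \<omega>) + c (\<theta> (Z s \<omega>))"
          by (simp add: mult.commute)
      qed
      then have "W \<omega> \<le> cost_process c p \<theta> Z U T \<omega>" using elim(1) T by (simp add: mult.commute)
      then show ?case by (auto simp: max_def ennreal_leI)
    qed
  qed
  finally show "ennreal (gam * T - 2 * K) \<le> expected_cost M c p \<theta> Z U T" .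
  assume cand: "\<theta> = cand_policy A c \<sigma> b p"
  \<comment> \<open>For the candidate, \<open>W\<close> is almost surely the cost itself, hence
    nonnegative; this allows its nonnegative integral to be replaced by its expectation.\<close>
  have "AE \<omega> in M. 0 \<le> W \<omega> \<and> cost_process c p \<theta> Z U T \<omega> = W \<omega>"
    using cost AE_space
  proof eventually_elim
    case (elim \<omega>)
    have "?J \<omega> = integral {0..T} (\<lambda>_. gam)"
    proof (rule Henstock_Kurzweil_Integration.integral_cong)
      fix s assume "s \<in> {0..T}"
      then have "Z s \<omega> \<in> {0..b}" using Zr[OF elim(2)] by auto
      from hjb_eq[OF this]
      show "\<sigma>\<^sup>2 / 2 * d (Z s \<omega>) - v (Z s \<omega>) * \<theta> (Z s \<omega>) + c (\<theta> (Z s \<omega>)) = gam"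
        unfolding cand by (simp add: mult.commute)
    qed
    then have eq: "cost_process c p \<theta> Z U T \<omega> = W \<omega>" using elim(1) T by (simp add: mult.commute)
    have "0 \<le> integral {0..T} (\<lambda>s. c (\<theta> (Z s \<omega>)))"
      using Zr[OF elim(2)] by (intro Henstock_Kurzweil_Integration.integral_nonneg path(2) elim(2) c_nonneg in_A) auto
    moreover have "mono_on {0..} (\<lambda>t. U t \<omega>)" "U 0 \<omega> = 0"
      using sk elim(2) unfolding skorohod_solution_def by blast+
    then have "0 \<le> U T \<omega>" using T mono_onD[of "{0..}" "\<lambda>t. U t \<omega>" 0 T] by simp
    ultimately have "0 \<le> cost_process c p \<theta> Z U T \<omega>" using p_pos by (simp add: cost_process_def)
    then show ?case using eq by simp
  qed
  then have W0: "AE \<omega> in M. 0 \<le> W \<omega>" and eq: "AE \<omega> in M. cost_process c p \<theta> Z U T \<omega> = W \<omega>" by auto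
  have "expected_cost M c p \<theta> Z U T = (\<integral>\<^sup>+\<omega>. ennreal (W \<omega>) \<partial>M)"
    unfolding expected_cost_def by (rule nn_integral_cong_AE) (use eq in auto)
  also have "\<dots> = ennreal (expectation W)" by (rule nn_integral_eq_integral[OF W W0])
  also have "\<dots> \<le> ennreal (gam * T + 2 * K)" using EW_bounds by (simp add: ennreal_leI)
  finally show "expected_cost M c p \<theta> Z U T \<le> ennreal (gam * T + 2 * K)" .
qed

lemma expected_cost_limits:
  fixes M :: "'w measure"
  assumes adm: "admissible A b \<theta>" and sk: "skorohod_solution M F \<sigma> b \<theta> z0 X Z L U" and z0: "z0 \<in> {0..b}"
  shows "ennreal gam \<le> Liminf at_top (\<lambda>t. expected_cost M c p \<theta> Z U t / ennreal t)"
    and "\<theta> = cand_policy A c \<sigma> b p \<Longrightarrow>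
      ((\<lambda>t. expected_cost M c p \<theta> Z U t / ennreal t) \<longlongrightarrow> ennreal gam) at_top"
proof -
  obtain K where K: "\<And>z. z \<in> {0..b} \<Longrightarrow> \<bar>f z\<bar> \<le> K"
    using compact_imp_bounded[OF compact_continuous_image[OF f_continuous compact_Icc]]
    unfolding bounded_real by blast
  note bounds = expected_cost_bounds[OF adm sk z0 _ K]
  have lim: "((\<lambda>t. ennreal (gam + a / t)) \<longlongrightarrow> ennreal gam) at_top" for a
  proof (intro tendsto_ennrealI)
    have "((\<lambda>t. gam + a / t) \<longlongrightarrow> gam + 0) at_top"
      by (intro tendsto_add tendsto_const tendsto_divide_0[OF tendsto_const] filterlim_at_top_imp_at_infinity filterlim_ident)
    then show "((\<lambda>t. gam + a / t) \<longlongrightarrow> gam) at_top" by simp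
  qed
  \<comment> \<open>Since gam > 0, the numerator is nonnegative once t exceeds - a / gam, so
    extended nonnegative division agrees with real division.\<close>
  have quot: "\<forall>\<^sub>F t in at_top. ennreal (gam * t + a) / ennreal t = ennreal (gam + a / t)" for a
    using eventually_gt_at_top[of "max 0 (- a / gam)"]
  proof eventually_elim
    case (elim t)
    then have t: "t > 0" "0 \<le> gam * t + a" using gam_pos by (auto simp: field_simps)
    then show ?case by (simp add: divide_ennreal add_divide_distrib)
  qed
  have lower: "\<forall>\<^sub>F t in at_top. ennreal (gam + (- 2 * K) / t) \<le> expected_cost M c p \<theta> Z U t / ennreal t"
    using quot[of "- 2 * K"] eventually_gt_at_top[of 0]
  proof eventually_elim
    case (elim t)
    have "ennreal (gam * t + - 2 * K) / ennreal t \<le> expected_cost M c p \<theta> Z U t / ennreal t"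
      using bounds(1)[OF elim(2)] by (intro divide_right_mono_ennreal) simp
    then show ?case using elim(1) by simp
  qed
  have "ennreal gam = Liminf at_top (\<lambda>t. ennreal (gam + (- 2 * K) / t))"
    by (rule lim_imp_Liminf[symmetric, OF _ lim]) simp
  also have "\<dots> \<le> Liminf at_top (\<lambda>t. expected_cost M c p \<theta> Z U t / ennreal t)"
    using lower by (rule Liminf_mono)
  finally show "ennreal gam \<le> Liminf at_top (\<lambda>t. expected_cost M c p \<theta> Z U t / ennreal t)" .
  assume cand: "\<theta> = cand_policy A c \<sigma> b p"
  have upper: "\<forall>\<^sub>F t in at_top. expected_cost M c p \<theta> Z U t / ennreal t \<le> ennreal (gam + (2 * K) / t)"
    using quot[of "2 * K"] eventually_gt_at_top[of 0]
  proof eventually_elim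
    case (elim t)
    have "expected_cost M c p \<theta> Z U t / ennreal t \<le> ennreal (gam * t + 2 * K) / ennreal t"
      using bounds(2)[OF elim(2) _ cand] by (intro divide_right_mono_ennreal) simp
    then show ?case using elim(1) by simp
  qed
  show "((\<lambda>t. expected_cost M c p \<theta> Z U t / ennreal t) \<longlongrightarrow> ennreal gam) at_top"
    by (rule tendsto_sandwich[OF lower upper lim lim])
qed

end

theorem theorem1:
  fixes A :: "real set" and c :: "real \<Rightarrow> real" and b \<sigma> p z0 :: real
  assumes "standing_assms A c" and "b > 0" and "\<sigma> > 0" and "p > 0" and "z0 \<in> {0..b}"
  shows "admissible A b (cand_policy A c \<sigma> b p)
    \<and> (\<forall>(M :: 'a measure) F X Z L U.
          skorohod_solution M F \<sigma> b (cand_policy A c \<sigma> b p) z0 X Z L U \<longrightarrow>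
          ((\<lambda>t. expected_cost M c p (cand_policy A c \<sigma> b p) Z U t / ennreal t)
             \<longlongrightarrow> ennreal (gamma A c \<sigma> b p)) at_top)
    \<and> (\<forall>\<theta> (M :: 'b measure) F X Z L U.
          admissible A b \<theta> \<and> skorohod_solution M F \<sigma> b \<theta> z0 X Z L U \<longrightarrow>
          ennreal (gamma A c \<sigma> b p)
            \<le> Liminf at_top (\<lambda>t. expected_cost M c p \<theta> Z U t / ennreal t))"
proof -
  interpret drift_control A c b \<sigma> p by unfold_locales (use assms in auto)
  show ?thesis
    using cand_admissible expected_cost_limits(1)[OF _ _ assms(5)]
      expected_cost_limits(2)[OF cand_admissible _ assms(5)]
    unfolding gam_def by blast
qed

end
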